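(* Suppose that an indeterminate normalized Hamburger moment problem has order zero. Let $c_k=\big(\sum_{n=k}^\infty b_{k,n}^2\big)^{1/2}$, where $b_{k,n}$ is the coefficient of $x^k$ in the orthonormal polynomial $P_n$, and let $\Phi(z)=\sum_{k=0}^\infty c_kz^k$ (an entire function). Then $\Phi$ has the same logarithmic order $\rho^{[1]}$ and logarithmic type $\tau^{[1]}$ as the moment problem.
   Context: A normalized Hamburger moment problem is given by a sequence $s_n=\int_{-\infty}^\infty x^n\,d\mu(x)$, $n\ge0$, where $\mu$ is a probability measure on $\mathbb R$ with infinite support and moments of every order. It is indeterminate if more than one measure $\mu$ has these moments. Let $P_n(x)=\sum_{k=0}^n b_{k,n}x^k$ be the orthonormal polynomials (positive leading coefficients) and $P(z)=(\sum_{n\ge0}|P_n(z)|^2)^{1/2}$; in the indeterminate case $P$ is finite and continuous on $\mathbb C$. It is known that in the indeterminate case the $c_k$ are finite and $\lim_k k\,c_k^{1/k}=0$, so $\Phi$ is entire. For an unbounded continuous $f:\mathbb C\to\mathbb C$ let $M_f(r)=\max_{|z|\le r}|f(z)|$. The order of $f$ is $\rho_f=\inf\{a>0\mid \log M_f(r)\le r^a\text{ for all large }r\}$. The logarithmic order is $\rho^{[1]}_f=\inf\{a>0\mid M_f(r)\le r^{(\log r)^a}\text{ for all large }r\}\in[0,\infty]$ (with $\inf\emptyset=\infty$), and when $\rho^{[1]}_f<\infty$ the logarithmic type is $\tau^{[1]}_f=\inf\{c>0\mid M_f(r)\le r^{c(\log r)^{\rho^{[1]}_f}}\text{ for all large }r\}$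 (with $\inf\emptyset=\infty$). Let $Q_n$ be the polynomials of the second kind, $Q(z)=(\sum_n|Q_n(z)|^2)^{1/2}$, and let $A(z)=z\sum_k Q_k(0)Q_k(z)$, $B(z)=-1+z\sum_k Q_k(0)P_k(z)$, $C(z)=1+z\sum_k P_k(0)Q_k(z)$, $D(z)=z\sum_k P_k(0)P_k(z)$. It is known that for an indeterminate problem the six functions $A,B,C,D,P,Q$ have the same order (the order of the moment problem), and if this order is zero they have the same logarithmic order and logarithmic type, called the logarithmic order $\rho^{[1]}$ and logarithmic type $\tau^{[1]}$ of the moment problem. *)

theory Defs
  imports
    "HOL-Probability.Probability"
    "HOL-Computational_Algebra.Polynomial"
begin

section \<open>Hamburger moment problems\<close>

definition measure_support :: "real measure \<Rightarrow> real set" where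
  "measure_support M = {x. \<forall>U. open U \<and> x \<in> U \<longrightarrow> emeasure M U > 0}"

definition has_moments :: "real measure \<Rightarrow> (nat \<Rightarrow> real) \<Rightarrow> bool" where
  "has_moments M s \<longleftrightarrow>
     sets M = sets borel \<and> (\<forall>n. integrable M (\<lambda>x. x ^ n) \<and> (LINT x|M. x ^ n) = s n)"

text \<open>\<^const>\<open>real_distribution\<close> means: a probability measure on the Borel sets of the real line.\<close>

definition normalized_hamburger :: "real measure \<Rightarrow> (nat \<Rightarrow> real) \<Rightarrow> bool" where
  "normalized_hamburger M s \<longleftrightarrow>
     real_distribution M \<and> infinite (measure_support M) \<and> has_moments M s"

definition indeterminate :: "(nat \<Rightarrow> real) \<Rightarrow> bool" where
  "indeterminate s \<longleftrightarrow> (\<exists>M N. has_moments M s \<and> has_moments N s \<and> M \<noteq> N)"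

text \<open>These conditions determine the sequence \<open>p\<close> uniquely.\<close>

definition orthonormal_polys :: "real measure \<Rightarrow> (nat \<Rightarrow> real poly) \<Rightarrow> bool" where
  "orthonormal_polys M p \<longleftrightarrow>
     (\<forall>n. degree (p n) = n \<and> lead_coeff (p n) > 0) \<and>
     (\<forall>m n. (LINT x|M. poly (p m) x * poly (p n) x) = (if m = n then 1 else 0))"


section \<open>The functions attached to a moment problem\<close>

definition cpoly :: "real poly \<Rightarrow> complex \<Rightarrow> complex" where
  "cpoly q z = poly (map_poly complex_of_real q) z"

text \<open>
  \<open>Q\<^sub>n(z) = \<integral> (P\<^sub>n(z) - P\<^sub>n(x)) / (z - x) d\<mu>(x)\<close>, where the quotient, a polynomial in
  \<open>x\<close> and \<open>z\<close>, takes the value \<open>P\<^sub>n'(z)\<close> for \<open>x = z\<close>.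
\<close>

definition second_kind :: "real measure \<Rightarrow> (nat \<Rightarrow> real poly) \<Rightarrow> nat \<Rightarrow> complex \<Rightarrow> complex" where
  "second_kind M p n z =
     (LINT x|M. (if complex_of_real x = z then cpoly (pderiv (p n)) z
                else (cpoly (p n) z - complex_of_real (poly (p n) x)) / (z - complex_of_real x)))"

text \<open>All the series below converge for indeterminate problems.\<close>

definition P_fun :: "(nat \<Rightarrow> real poly) \<Rightarrow> complex \<Rightarrow> complex" where
  "P_fun p z = complex_of_real (sqrt (\<Sum>n. (cmod (cpoly (p n) z))\<^sup>2))"

definition Q_fun :: "real measure \<Rightarrow> (nat \<Rightarrow> real poly) \<Rightarrow> complex \<Rightarrow> complex" where
  "Q_fun M p z = complex_of_real (sqrt (\<Sum>n. (cmod (second_kind M p n z))\<^sup>2))"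

definition A_fun :: "real measure \<Rightarrow> (nat \<Rightarrow> real poly) \<Rightarrow> complex \<Rightarrow> complex" where
  "A_fun M p z = z * (\<Sum>k. second_kind M p k 0 * second_kind M p k z)"

definition B_fun :: "real measure \<Rightarrow> (nat \<Rightarrow> real poly) \<Rightarrow> complex \<Rightarrow> complex" where
  "B_fun M p z = - 1 + z * (\<Sum>k. second_kind M p k 0 * cpoly (p k) z)"

definition C_fun :: "real measure \<Rightarrow> (nat \<Rightarrow> real poly) \<Rightarrow> complex \<Rightarrow> complex" where
  "C_fun M p z = 1 + z * (\<Sum>k. cpoly (p k) 0 * second_kind M p k z)"

definition D_fun :: "(nat \<Rightarrow> real poly) \<Rightarrow> complex \<Rightarrow> complex" where
  "D_fun p z = z * (\<Sum>k. cpoly (p k) 0 * cpoly (p k) z)"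

definition moment_funs :: "real measure \<Rightarrow> (nat \<Rightarrow> real poly) \<Rightarrow> (complex \<Rightarrow> complex) set" where
  "moment_funs M p = {A_fun M p, B_fun M p, C_fun M p, D_fun p, P_fun p, Q_fun M p}"

definition c_coeff :: "(nat \<Rightarrow> real poly) \<Rightarrow> nat \<Rightarrow> real" where
  "c_coeff p k = sqrt (\<Sum>n. (coeff (p (k + n)) k)\<^sup>2)"

definition Phi_fun :: "(nat \<Rightarrow> real poly) \<Rightarrow> complex \<Rightarrow> complex" where
  "Phi_fun p z = (\<Sum>k. complex_of_real (c_coeff p k) * z ^ k)"


section \<open>Order, logarithmic order and logarithmic type\<close>

text \<open>
  The notions are meant for unbounded continuous \<open>f\<close>; the supremum is then a maximum. The infima
  are taken in \<^typ>\<open>ereal\<close>, where the infimum of the empty set is \<open>\<infinity>\<close>.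
\<close>

definition max_modulus :: "(complex \<Rightarrow> complex) \<Rightarrow> real \<Rightarrow> real" where
  "max_modulus f r = (SUP z\<in>cball 0 r. cmod (f z))"

definition growth_order :: "(complex \<Rightarrow> complex) \<Rightarrow> ereal" where
  "growth_order f =
     Inf (ereal ` {a. a > 0 \<and> (\<forall>\<^sub>F r in at_top. ln (max_modulus f r) \<le> r powr a)})"

definition log_order :: "(complex \<Rightarrow> complex) \<Rightarrow> ereal" where
  "log_order f =
     Inf (ereal ` {a. a > 0 \<and> (\<forall>\<^sub>F r in at_top. max_modulus f r \<le> r powr (ln r powr a))})"

text \<open>Only meaningful if the logarithmic order is finite.\<close>

definition log_type :: "(complex \<Rightarrow> complex) \<Rightarrow> ereal" where
  "log_type f =
     Inf (ereal ` {c. c > 0 \<and> (\<forall>\<^sub>F r in at_top.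
       max_modulus f r \<le> r powr (c * ln r powr real_of_ereal (log_order f)))})"

text \<open>
  The order, logarithmic order and logarithmic type of a moment problem are the common values of
  these quantities for the six functions in \<^const>\<open>moment_funs\<close>.
\<close>

definition moment_problem_order ::
    "real measure \<Rightarrow> (nat \<Rightarrow> real poly) \<Rightarrow> ereal \<Rightarrow> bool" where
  "moment_problem_order M p \<rho> \<longleftrightarrow> (\<forall>f\<in>moment_funs M p. growth_order f = \<rho>)"

definition moment_problem_log_order ::
    "real measure \<Rightarrow> (nat \<Rightarrow> real poly) \<Rightarrow> ereal \<Rightarrow> bool" where
  "moment_problem_log_order M p \<rho> \<longleftrightarrow> (\<forall>f\<in>moment_funs M p. log_order f = \<rho>)"

definition moment_problem_log_type ::
    "real measure \<Rightarrow> (nat \<Rightarrow> real poly) \<Rightarrow> ereal \<Rightarrow> bool" where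
  "moment_problem_log_type M p \<tau> \<longleftrightarrow> (\<forall>f\<in>moment_funs M p. log_type f = \<tau>)"

end

theory Submission
  imports
    Defs
    "HOL-Complex_Analysis.Complex_Analysis"
    "HOL-Real_Asymp.Real_Asymp"
begin

text \<open>
  The logarithmic order and type do not change when \<open>M\<^sub>f(r)\<close> is replaced by \<open>C r\<^sup>K M\<^sub>f(L r)\<close> (for
  the type, \<open>f\<close> must grow faster than every polynomial), so it suffices to bound the maximum moduli
  of the seven functions against each other in this sense.

  If two measures have the same moments, their Stieltjes transforms \<open>w\<close> differ at some non-real
  point. Bessel's inequality for \<open>1 / (x - z)\<close> bounds \<open>\<Sum> |w P\<^sub>n + Q\<^sub>n|\<^sup>2\<close>
  for both of them, hence \<open>P\<close> and \<open>Q\<close> are finite there. Variation of constants and a discrete Gronwall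
  inequality make them locally bounded. The same Bessel inequality compares \<open>P\<close> with \<open>Q\<close>.
  Cauchy's estimates give \<open>c\<^sub>k \<le> R\<^sup>-\<^sup>k M\<^sub>P(R)\<close>, while \<open>P(z) \<le> \<Phi>(|z|)\<close>
  is the triangle inequality. Finally the kernel identity
  \<open>(a - b) \<Sum> P\<^sub>n(a) P\<^sub>n(b) = B(a) D(b) - D(a) B(b)\<close>, and its analogue for \<open>Q\<close>, \<open>A\<close>,
  \<open>C\<close>, bounds \<open>P(z)\<close> by each of \<open>|B(z)|\<close> and \<open>|D(z)|\<close> up to a factor \<open>(|z| + 1) / |Im z|\<close>; the singularity
  of such factors at the real axis is removed by the maximum principle.
\<close>

section \<open>Comparison of growth\<close>

text \<open>The dilation \<open>L\<close> absorbs the larger discs of Cauchy's estimates and of the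
  maximum principle, \<open>C * r powr K\<close> the polynomial factors. Both are harmless on the
  logarithmic scale, where ln (L r) is asymptotic to ln r.\<close>

definition growth_le :: "(complex \<Rightarrow> complex) \<Rightarrow> (complex \<Rightarrow> complex) \<Rightarrow> bool" where
  "growth_le f g \<longleftrightarrow> (\<exists>C>0. \<exists>K\<ge>0. \<exists>L\<ge>1. \<forall>\<^sub>F r in at_top.
     max_modulus f r \<le> C * r powr K * max_modulus g (L * r))"

text \<open>Serves the case of logarithmic order 0: there the type compares
  \<open>max_modulus\<close> with mere powers of \<open>r\<close>, against which a factor
  \<open>r powr K\<close> would matter.\<close>

definition superpolynomial :: "(complex \<Rightarrow> complex) \<Rightarrow> bool" where
  "superpolynomial f \<longleftrightarrow> (\<forall>c. \<not> (\<forall>\<^sub>F r in at_top. max_modulus f r \<le> r powr c))"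

lemma eventually_at_top_scale:
  fixes P :: "real \<Rightarrow> bool"
  assumes "\<forall>\<^sub>F r in at_top. P r" "L > 0"
  shows "\<forall>\<^sub>F r in at_top. P (L * r)"
proof -
  have "filterlim (\<lambda>r. L * r) at_top at_top"
    using assms(2) by real_asymp
  then show ?thesis
    using assms(1) by (simp add: filterlim_iff)
qed

lemma growth_le_trans:
  assumes "growth_le f g" "growth_le g h"
  shows "growth_le f h"
proof -
  from assms(1) obtain C K L where 1: "C > 0" "K \<ge> 0" "L \<ge> 1"
    "\<forall>\<^sub>F r in at_top. max_modulus f r \<le> C * r powr K * max_modulus g (L * r)"
    unfolding growth_le_def by blast
  from assms(2) obtain C' K' L' where 2: "C' > 0" "K' \<ge> 0" "L' \<ge> 1"
    "\<forall>\<^sub>F r in at_top. max_modulus g r \<le> C' * r powr K' * max_modulus h (L' * r)"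
    unfolding growth_le_def by blast
  have 3: "\<forall>\<^sub>F r in at_top. max_modulus g (L * r) \<le> C' * (L * r) powr K' * max_modulus h (L' * (L * r))"
    using eventually_at_top_scale[OF 2(4)] 1 by simp
  have "\<forall>\<^sub>F r in at_top. max_modulus f r \<le> (C * C' * L powr K') * r powr (K + K') * max_modulus h ((L' * L) * r)"
    using 1(4) 3 eventually_gt_at_top[of 0]
  proof eventually_elim
    case (elim r)
    have "max_modulus f r \<le> C * r powr K * (C' * (L * r) powr K' * max_modulus h (L' * (L * r)))"
      by (rule order_trans[OF elim(1)]) (use elim 1 in \<open>auto intro!: mult_left_mono\<close>)
    then show ?case
      using elim 1 by (simp add: powr_mult powr_add mult_ac)
  qed
  moreover have "C * C' * L powr K' > 0" "K + K' \<ge> 0" "L' * L \<ge> 1"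
    using 1 2 by (auto simp: mult_ge1_I)
  ultimately show ?thesis
    unfolding growth_le_def by blast
qed

text \<open>With an exponent \<open>e\<close> depending on \<open>r\<close>, one statement covers
  the bounds defining logarithmic order, logarithmic type and polynomial growth.\<close>

lemma growth_le_powr:
  assumes "growth_le f g"
  obtains C K L where "C > 0" "K \<ge> 0" "L \<ge> 1"
    "\<And>e. \<forall>\<^sub>F r in at_top. max_modulus g r \<le> r powr e r \<Longrightarrow>
      \<forall>\<^sub>F r in at_top. max_modulus f r \<le> C * r powr K * (L * r) powr e (L * r)"
proof -
  from assms obtain C K L where 1: "C > 0" "K \<ge> 0" "L \<ge> 1"
    "\<forall>\<^sub>F r in at_top. max_modulus f r \<le> C * r powr K * max_modulus g (L * r)"
    unfolding growth_le_def by blast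
  show thesis
  proof (rule that[OF 1(1,2,3)])
    fix e :: "real \<Rightarrow> real" assume "\<forall>\<^sub>F r in at_top. max_modulus g r \<le> r powr e r"
    from eventually_at_top_scale[OF this, of L] 1
    have "\<forall>\<^sub>F r in at_top. max_modulus g (L * r) \<le> (L * r) powr e (L * r)" by simp
    with 1(4) eventually_gt_at_top[of 0]
    show "\<forall>\<^sub>F r in at_top. max_modulus f r \<le> C * r powr K * (L * r) powr e (L * r)"
    proof eventually_elim
      case (elim r)
      show ?case
        by (rule order_trans[OF elim(1)]) (use elim 1 in \<open>auto intro!: mult_left_mono\<close>)
    qed
  qed
qed

lemma eventually_powr_ln_powr_le:
  fixes C K L a e :: real
  assumes "C > 0" "K \<ge> 0" "L \<ge> 1" "a > 0" "e > 0"
  shows "\<forall>\<^sub>F r in at_top. C * r powr K * (L * r) powr (ln (L * r) powr a) \<le> r powr (ln r powr (a + e))"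
  using assms by real_asymp

lemma eventually_powr_type_le:
  fixes C K L a c d :: real
  assumes "C > 0" "K \<ge> 0" "L \<ge> 1" "a > 0" "c > 0" "d > c"
  shows "\<forall>\<^sub>F r in at_top. C * r powr K * (L * r) powr (c * ln (L * r) powr a) \<le> r powr (d * ln r powr a)"
proof -
  \<comment> \<open>Quotient of the logarithms of both sides, up to \<open>d\<close>. Since a > 0,
    the terms \<open>ln C\<close> and \<open>K * ln r\<close> are of lower order than the
    denominator.\<close>
  have "((\<lambda>r. (ln C + K * ln r + c * (ln (L * r) powr a * ln (L * r))) / (ln r powr a * ln r)) \<longlongrightarrow> c) at_top"
    using assms by real_asymp
  from order_tendstoD(2)[OF this assms(6)] eventually_gt_at_top[of 1]
  show ?thesis
  proof eventually_elim
    case (elim r)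
    have "ln (C * r powr K * (L * r) powr (c * ln (L * r) powr a))
        = ln C + K * ln r + c * (ln (L * r) powr a * ln (L * r))"
      using assms elim by (simp add: ln_mult ln_powr)
    also have "\<dots> \<le> d * (ln r powr a * ln r)"
      using elim by (simp add: divide_simps)
    also have "\<dots> = ln (r powr (d * ln r powr a))"
      using elim by (simp add: ln_powr)
    finally show ?case
      using assms elim by (subst (asm) ln_le_cancel_iff) auto
  qed
qed

lemma eventually_powr_poly_le:
  fixes C K L c :: real
  assumes "C > 0" "K \<ge> 0" "L \<ge> 1"
  shows "\<forall>\<^sub>F r in at_top. C * r powr K * (L * r) powr c \<le> r powr (K + c + 1)"
  using assms by real_asymp

lemma log_order_nonneg: "log_order f \<ge> 0"
  unfolding log_order_def by (rule Inf_greatest) auto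

lemma log_order_mono:
  assumes "growth_le f g"
  shows "log_order f \<le> log_order g"
proof -
  obtain C K L where CKL: "C > 0" "K \<ge> 0" "L \<ge> 1"
    and imp: "\<And>e. \<forall>\<^sub>F r in at_top. max_modulus g r \<le> r powr e r \<Longrightarrow>
      \<forall>\<^sub>F r in at_top. max_modulus f r \<le> C * r powr K * (L * r) powr e (L * r)"
    using growth_le_powr[OF assms] by blast
  have "log_order f \<le> ereal a"
    if a: "a > 0" "\<forall>\<^sub>F r in at_top. max_modulus g r \<le> r powr (ln r powr a)" for a
  proof (rule ereal_le_epsilon2)
    \<comment> \<open>Factor and dilation cost an arbitrarily small \<open>e\<close> in the
      exponent, which the infimum does not see.\<close>
    fix e :: real assume e: "e > 0"
    have "\<forall>\<^sub>F r in at_top. max_modulus f r \<le> r powr (ln r powr (a + e))"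
      using imp[OF a(2)] eventually_powr_ln_powr_le[OF CKL a(1) e]
      by eventually_elim simp
    then have "log_order f \<le> ereal (a + e)"
      unfolding log_order_def using a e by (intro Inf_lower) auto
    then show "log_order f \<le> ereal a + ereal e" by simp
  qed
  then show ?thesis
    unfolding log_order_def[of g] by (intro Inf_greatest) auto
qed

lemma superpolynomial_mono:
  assumes "growth_le f g" "superpolynomial f"
  shows "superpolynomial g"
  unfolding superpolynomial_def
proof (intro allI notI)
  fix c :: real assume *: "\<forall>\<^sub>F r in at_top. max_modulus g r \<le> r powr c"
  obtain C K L where CKL: "C > 0" "K \<ge> 0" "L \<ge> 1"
    and imp: "\<And>e. \<forall>\<^sub>F r in at_top. max_modulus g r \<le> r powr e r \<Longrightarrow>
      \<forall>\<^sub>F r in at_top. max_modulus f r \<le> C * r powr K * (L * r) powr e (L * r)"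
    using growth_le_powr[OF assms(1)] by blast
  have "\<forall>\<^sub>F r in at_top. max_modulus f r \<le> r powr (K + c + 1)"
    using imp[OF *] eventually_powr_poly_le[OF CKL, of c] by eventually_elim simp
  with assms(2) show False by (auto simp: superpolynomial_def)
qed

text \<open>For positive order the losses fit into an arbitrarily small increase of
  \<open>c\<close>. For order 0, a bound with any \<open>c\<close> would make \<open>g\<close>
  polynomially bounded, so the infimum for \<open>g\<close> runs over the empty set.\<close>

lemma log_type_mono:
  assumes "growth_le f g" "log_order f = log_order g" "log_order g < \<infinity>" "superpolynomial g"
  shows "log_type f \<le> log_type g"
proof -
  obtain C K L where CKL: "C > 0" "K \<ge> 0" "L \<ge> 1"
    and imp: "\<And>e. \<forall>\<^sub>F r in at_top. max_modulus g r \<le> r powr e r \<Longrightarrow>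
      \<forall>\<^sub>F r in at_top. max_modulus f r \<le> C * r powr K * (L * r) powr e (L * r)"
    using growth_le_powr[OF assms(1)] by blast
  define a where "a = real_of_ereal (log_order g)"
  have "a \<ge> 0"
    unfolding a_def using log_order_nonneg by (rule real_of_ereal_pos)
  have "log_type f \<le> ereal c"
    if c: "c > 0" "\<forall>\<^sub>F r in at_top. max_modulus g r \<le> r powr (c * ln r powr a)" for c
  proof (cases "a = 0")
    case True
    \<comment> \<open>\<open>ln r powr 0\<close> equals 1 only if \<open>ln r\<close> is nonzero,
      hence the restriction to r > 1.\<close>
    have "\<forall>\<^sub>F r in at_top. max_modulus g r \<le> r powr c"
      using c(2) eventually_gt_at_top[of 1] by eventually_elim (simp add: True)
    with assms(4) show ?thesis by (auto simp: superpolynomial_def)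
  next
    case False
    with \<open>a \<ge> 0\<close> have "a > 0" by simp
    show ?thesis
    proof (rule ereal_le_epsilon2)
      fix e :: real assume e: "e > 0"
      have "\<forall>\<^sub>F r in at_top. max_modulus f r \<le> r powr ((c + e) * ln r powr a)"
        using imp[OF c(2)] eventually_powr_type_le[OF CKL \<open>a > 0\<close> c(1), of "c + e"] e
        by (auto elim: eventually_elim2)
      then have "log_type f \<le> ereal (c + e)"
        unfolding log_type_def assms(2) a_def using c e by (intro Inf_lower) auto
      then show "log_type f \<le> ereal c + ereal e" by simp
    qed
  qed
  then show ?thesis
    unfolding log_type_def[of g] a_def by (intro Inf_greatest) auto
qed

section \<open>Maximum moduli of locally bounded functions\<close>

lemma max_modulus_leI:
  assumes "r \<ge> 0" "\<And>z. cmod z \<le> r \<Longrightarrow> cmod (f z) \<le> B"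
  shows "max_modulus f r \<le> B"
  unfolding max_modulus_def using assms by (intro cSUP_least) auto

lemma norm_le_max_modulus:
  assumes "\<And>z. cmod z \<le> r \<Longrightarrow> cmod (f z) \<le> B" "cmod z \<le> r"
  shows "cmod (f z) \<le> max_modulus f r"
  unfolding max_modulus_def using assms by (intro cSUP_upper bdd_aboveI2[where M=B]) auto

text \<open>The real supremum in \<open>max_modulus\<close> carries no information for an unbounded
  set; local boundedness makes it dominate the values.\<close>

definition locally_bounded :: "(complex \<Rightarrow> complex) \<Rightarrow> bool" where
  "locally_bounded f \<longleftrightarrow> (\<forall>r. \<exists>B. \<forall>z. cmod z \<le> r \<longrightarrow> cmod (f z) \<le> B)"

lemma locally_bounded_norm_le_max_modulus:
  assumes "locally_bounded f" "cmod z \<le> r"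
  shows "cmod (f z) \<le> max_modulus f r"
  using assms norm_le_max_modulus[of r f] unfolding locally_bounded_def by meson

lemma growth_leI:
  assumes "\<And>r z. r \<ge> 1 \<Longrightarrow> cmod z \<le> r \<Longrightarrow> cmod (f z) \<le> C * r ^ k * max_modulus g (L * r)" "C > 0" "L \<ge> 1"
  shows "growth_le f g"
proof -
  have "\<forall>\<^sub>F r in at_top. max_modulus f r \<le> C * r powr real k * max_modulus g (L * r)"
    using eventually_ge_at_top[of 1]
  proof eventually_elim
    case (elim r)
    then show ?case using assms(1)[of r] by (intro max_modulus_leI) (auto simp: powr_realpow)
  qed
  then show ?thesis
    unfolding growth_le_def using assms by (intro exI[of _ C] exI[of _ "real k"] exI[of _ L] conjI) auto
qed

section \<open>Square-summable sequences of entire functions\<close>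

definition l2 :: "(nat \<Rightarrow> 'a \<Rightarrow> complex) \<Rightarrow> 'a \<Rightarrow> real" where
  "l2 u z = sqrt (\<Sum>k. (cmod (u k z))\<^sup>2)"

definition square_summable :: "(nat \<Rightarrow> 'a \<Rightarrow> complex) \<Rightarrow> 'a \<Rightarrow> bool" where
  "square_summable u z \<longleftrightarrow> summable (\<lambda>k. (cmod (u k z))\<^sup>2)"

lemma L2_set_le_l2:
  assumes "square_summable u z"
  shows "L2_set (\<lambda>k. cmod (u k z)) {..<N} \<le> l2 u z"
  unfolding L2_set_def l2_def
  by (rule real_sqrt_le_mono, rule sum_le_suminf) (use assms in \<open>auto simp: square_summable_def\<close>)

text \<open>Uniform bounds on finite sections give convergence and the bound together. Estimates are
  therefore proved for finite \<open>L2_set\<close>s first, where holomorphy and the triangle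
  inequality raise no question of convergence.\<close>

lemma l2_leI:
  assumes "\<And>N. L2_set (\<lambda>k. cmod (u k z)) {..<N} \<le> B"
  shows "square_summable u z" "l2 u z \<le> B"
proof -
  have B: "B \<ge> 0" using assms[of 0] by simp
  have *: "(\<Sum>k<N. (cmod (u k z))\<^sup>2) \<le> B\<^sup>2" for N
    using assms[of N] B unfolding L2_set_def by (simp add: real_le_lsqrt sqrt_le_D sum_nonneg)
  show s: "square_summable u z"
    unfolding square_summable_def by (rule summableI_nonneg_bounded[OF _ *]) simp
  show "l2 u z \<le> B"
    unfolding l2_def
    using suminf_le_const[OF s[unfolded square_summable_def] *] B by (simp add: real_le_lsqrt)
qed

lemma l2_nonneg: "square_summable u z \<Longrightarrow> l2 u z \<ge> 0"
  unfolding l2_def square_summable_def by (auto intro: suminf_nonneg)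

lemma l2_power2:
  assumes "square_summable u z"
  shows "(l2 u z)\<^sup>2 = (\<Sum>k. (cmod (u k z))\<^sup>2)"
  using assms unfolding l2_def square_summable_def by (simp add: suminf_nonneg)

lemma norm_le_l2:
  assumes "square_summable u z"
  shows "cmod (u k z) \<le> l2 u z"
proof -
  have "cmod (u k z) \<le> L2_set (\<lambda>k. cmod (u k z)) {..<Suc k}"
    by (rule member_le_L2_set) auto
  also have "\<dots> \<le> l2 u z" by (rule L2_set_le_l2[OF assms])
  finally show ?thesis .
qed

lemma norm_sum_mult_le_L2_set:
  "cmod (\<Sum>k\<in>A. f k * g k) \<le> L2_set (\<lambda>k. cmod (f k)) A * L2_set (\<lambda>k. cmod (g k)) A"
proof -
  have "cmod (\<Sum>k\<in>A. f k * g k) \<le> (\<Sum>k\<in>A. \<bar>cmod (f k)\<bar> * \<bar>cmod (g k)\<bar>)"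
    by (rule order_trans[OF norm_sum]) (simp add: norm_mult)
  also have "\<dots> \<le> L2_set (\<lambda>k. cmod (f k)) A * L2_set (\<lambda>k. cmod (g k)) A"
    by (rule L2_set_mult_ineq)
  finally show ?thesis .
qed

lemma summable_mult_square_summable:
  assumes "square_summable u a" "square_summable v b"
  shows "summable (\<lambda>k. u k a * v k b)" "cmod (\<Sum>k. u k a * v k b) \<le> l2 u a * l2 v b"
proof -
  have fin: "(\<Sum>k\<in>A. cmod (u k a * v k b)) \<le> l2 u a * l2 v b" if A: "A = {..<N}" for A N
  proof -
    have "(\<Sum>k\<in>A. cmod (u k a * v k b)) \<le> L2_set (\<lambda>k. cmod (u k a)) A * L2_set (\<lambda>k. cmod (v k b)) A"
      using L2_set_mult_ineq[of "\<lambda>k. cmod (u k a)" "\<lambda>k. cmod (v k b)" A] by (simp add: norm_mult)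
    also have "\<dots> \<le> l2 u a * l2 v b"
      unfolding A using assms by (intro mult_mono L2_set_le_l2 l2_nonneg) auto
    finally show ?thesis .
  qed
  have s: "summable (\<lambda>k. cmod (u k a * v k b))"
    by (rule summableI_nonneg_bounded[OF _ fin[OF refl]]) simp
  then show "summable (\<lambda>k. u k a * v k b)" by (rule summable_norm_cancel)
  have "cmod (\<Sum>k. u k a * v k b) \<le> (\<Sum>k. cmod (u k a * v k b))"
    by (rule summable_norm[OF s])
  also have "\<dots> \<le> l2 u a * l2 v b"
    by (rule suminf_le_const[OF s fin[OF refl]])
  finally show "cmod (\<Sum>k. u k a * v k b) \<le> l2 u a * l2 v b" .
qed

text \<open>
  A bound that degenerates like \<open>1 / (Im \<zeta>)\<^sup>2\<close> at the real axis still gives a bound across the axis: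
  apply the maximum principle on the disc of radius 2 about \<open>Re z\<close> after multiplication with
  \<open>((\<zeta> - Re z)\<^sup>2 - 4)\<^sup>2\<close>, whose modulus on the boundary circle is \<open>16 (Im \<zeta>)\<^sup>2\<close>.
\<close>

lemma L2_set_bound_across_real_axis:
  fixes f :: "nat \<Rightarrow> complex \<Rightarrow> complex"
  assumes hol: "\<And>k. f k holomorphic_on UNIV"
    and bound: "\<And>\<zeta>. cmod \<zeta> \<le> r + 2 \<Longrightarrow> Im \<zeta> \<noteq> 0 \<Longrightarrow>
      L2_set (\<lambda>k. cmod (f k \<zeta>)) {..<N} * (Im \<zeta>)\<^sup>2 \<le> B"
    and z: "cmod z \<le> r"
  shows "L2_set (\<lambda>k. cmod (f k z)) {..<N} \<le> B"
proof -
  define L where "L \<zeta> = L2_set (\<lambda>k. cmod (f k \<zeta>)) {..<N}" for \<zeta>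
  have L0: "L \<zeta> \<ge> 0" for \<zeta> unfolding L_def by simp
  have r: "r \<ge> 0" using z norm_ge_zero[of z] by linarith
  \<comment> \<open>The point \<open>\<i>\<close> lies in the disc of radius \<open>r + 2\<close>
    and yields B \<ge> 0, with which the bound extends trivially to real points.\<close>
  have "L \<i> * (Im \<i>)\<^sup>2 \<le> B" unfolding L_def using r by (intro bound) auto
  with L0[of \<i>] have B0: "B \<ge> 0" by simp
  have bound': "L \<zeta> * (Im \<zeta>)\<^sup>2 \<le> B" if "cmod \<zeta> \<le> r + 2" for \<zeta>
    using bound[of \<zeta>] that B0 by (cases "Im \<zeta> = 0") (auto simp: L_def)
  have "L z \<le> B"
  proof (cases "\<bar>Im z\<bar> \<ge> 1")
    case True
    then have "1 \<le> (Im z)\<^sup>2" by (metis abs_le_square_iff abs_one one_power2)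
    then have "L z * 1 \<le> L z * (Im z)\<^sup>2" using L0 by (intro mult_left_mono)
    then show ?thesis using bound'[of z] z by simp
  next
    case False
    define x where "x = complex_of_real (Re z)"
    define g where "g \<zeta> = ((\<zeta> - x)\<^sup>2 - 4)\<^sup>2" for \<zeta> :: complex
    \<comment> \<open>Pairing with the fixed vector of the \<open>f k z\<close> replaces a vector of
      functions by a single holomorphic function; at \<open>z\<close> the sum is the squared
      norm.\<close>
    define h where "h \<zeta> = g \<zeta> * (\<Sum>k<N. cnj (f k z) * f k \<zeta>)" for \<zeta>
    have hol_h: "h holomorphic_on UNIV"
      unfolding h_def g_def by (intro holomorphic_intros hol)
    have nx: "cmod x \<le> r" unfolding x_def using z abs_Re_le_cmod[of z] by simp
    have "cmod (h z) \<le> 16 * B * L z"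
    proof (rule maximum_modulus_frontier[of h "cball x 2"])
      show "h holomorphic_on interior (cball x 2)"
        using hol_h by (rule holomorphic_on_subset) auto
      show "continuous_on (closure (cball x 2)) h"
        using hol_h by (intro holomorphic_on_imp_continuous_on) (rule holomorphic_on_subset, auto)
      show "z \<in> cball x 2"
      proof -
        have "z - x = \<i> * Im z" by (simp add: x_def complex_eq_iff)
        then have "cmod (z - x) = \<bar>Im z\<bar>" by (simp add: norm_mult)
        then show ?thesis using False by (simp add: dist_norm norm_minus_commute)
      qed
      fix \<zeta> assume "\<zeta> \<in> frontier (cball x 2)"
      then have \<zeta>: "cmod (\<zeta> - x) = 2" by (simp add: dist_norm norm_minus_commute)
      have "cmod \<zeta> \<le> cmod x + cmod (\<zeta> - x)" by (metis add.commute diff_add_cancel norm_triangle_ineq)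
      then have n\<zeta>: "cmod \<zeta> \<le> r + 2" using \<zeta> nx by simp
      define w where "w = \<zeta> - x"
      have "cmod w = 2" using \<zeta> by (simp add: w_def)
      \<comment> \<open>On the circle 4 = |w|^2, so w^2 - 4 factors as w (w - cnj w), where w - cnj
        w is 2i times the imaginary part of \<zeta>.\<close>
      then have "4 = w * cnj w" using complex_norm_square[of w] by simp
      then have "w\<^sup>2 - 4 = w * (w - cnj w)" by (simp add: power2_eq_square right_diff_distrib)
      moreover have "w - cnj w = 2 * \<i> * Im \<zeta>" by (simp add: w_def x_def complex_eq_iff)
      ultimately have "cmod (w\<^sup>2 - 4) = 4 * \<bar>Im \<zeta>\<bar>" using \<open>cmod w = 2\<close> by (simp add: norm_mult)
      then have g: "cmod (g \<zeta>) = 16 * (Im \<zeta>)\<^sup>2" by (simp add: g_def w_def norm_power power_mult_distrib)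
      have "cmod (\<Sum>k<N. cnj (f k z) * f k \<zeta>) \<le> L z * L \<zeta>"
        using norm_sum_mult_le_L2_set[of "\<lambda>k. cnj (f k z)" "\<lambda>k. f k \<zeta>" "{..<N}"] by (simp add: L_def)
      then have "cmod (h \<zeta>) \<le> 16 * (Im \<zeta>)\<^sup>2 * (L z * L \<zeta>)"
        unfolding h_def norm_mult g by (intro mult_left_mono) auto
      also have "\<dots> = 16 * L z * (L \<zeta> * (Im \<zeta>)\<^sup>2)" by simp
      also have "\<dots> \<le> 16 * L z * B" using bound'[OF n\<zeta>] L0 by (intro mult_left_mono) auto
      finally show "cmod (h \<zeta>) \<le> 16 * B * L z" by (simp add: mult_ac)
    qed auto
    \<comment> \<open>Since \<open>z - x\<close> is purely imaginary, the weight \<open>g z\<close>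
      has modulus at least 16; afterwards one factor \<open>L z\<close> cancels.\<close>
    moreover have "16 * (L z)\<^sup>2 \<le> cmod (h z)"
    proof -
      have "(z - x)\<^sup>2 - 4 = - of_real ((Im z)\<^sup>2 + 4)"
        by (simp add: x_def complex_eq_iff power2_eq_square)
      then have "g z = of_real (((Im z)\<^sup>2 + 4)\<^sup>2)"
        by (simp only: g_def power2_minus of_real_power)
      then have "cmod (g z) = ((Im z)\<^sup>2 + 4)\<^sup>2" by (simp only: norm_of_real) simp
      moreover have "4\<^sup>2 \<le> ((Im z)\<^sup>2 + 4)\<^sup>2" by (rule power_mono) auto
      ultimately have "16 \<le> cmod (g z)" by simp
      moreover have "(\<Sum>k<N. cnj (f k z) * f k z) = of_real ((L z)\<^sup>2)"
        unfolding L_def L2_set_def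
        by (simp add: sum_nonneg complex_norm_square mult.commute flip: of_real_power)
      ultimately show ?thesis
        unfolding h_def norm_mult by (simp add: mult_right_mono norm_power)
    qed
    ultimately have "L z * L z \<le> B * L z" by (simp add: power2_eq_square)
    then show ?thesis using L0[of z] B0 by (cases "L z = 0") auto
  qed
  then show ?thesis by (simp add: L_def)
qed

text \<open>
  Eliminating \<open>G\<close> from the kernel identity for the three pairs formed from \<open>z\<close>, its conjugate and
  \<open>\<i>\<close> gives a linear relation between \<open>F z\<close>, \<open>F (cnj z)\<close> and \<open>F \<i>\<close>.
\<close>

lemma kernel_diagonal_bound:
  fixes F G :: "complex \<Rightarrow> complex" and U :: "complex \<Rightarrow> real"
  assumes id: "\<And>a b. (a - b) * K a b = F a * G b - G a * F b"
    and F_cnj: "\<And>z. F (cnj z) = cnj (F z)" and U_cnj: "\<And>z. U (cnj z) = U z"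
    and K_le: "\<And>a b. cmod (K a b) \<le> U a * U b"
    and K_diag: "\<And>z. K z (cnj z) = of_real ((U z)\<^sup>2)"
    and U_nonneg: "\<And>z. U z \<ge> 0" and U_i: "U \<i> > 0"
  shows "F \<i> \<noteq> 0" "U z * \<bar>Im z\<bar> \<le> U \<i> / cmod (F \<i>) * ((cmod z + 1) * cmod (F z))"
proof -
  show Fi: "F \<i> \<noteq> 0"
  proof
    \<comment> \<open>By symmetry \<open>F\<close> would vanish at \<open>cnj \<i>\<close> as well,
      and the identity would force \<open>K \<i> (cnj \<i>)\<close>, the square of
      \<open>U \<i>\<close>, to be 0.\<close>
    assume 0: "F \<i> = 0"
    then have "F (cnj \<i>) = 0" unfolding F_cnj by simp
    with 0 id[of \<i> "cnj \<i>"] have "K \<i> (cnj \<i>) = 0" by simp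
    with K_diag[of \<i>] U_i show False by simp
  qed
  \<comment> \<open>The right-hand sides of \<open>id\<close> are 2x2 minors; this cyclic sum is the
    expansion of a 3x3 determinant with two equal rows of values of \<open>F\<close>.\<close>
  have "F z * ((cnj z - \<i>) * K (cnj z) \<i>) + F (cnj z) * ((\<i> - z) * K \<i> z)
      + F \<i> * ((z - cnj z) * K z (cnj z)) = 0"
    unfolding id by (simp add: algebra_simps)
  then have "F \<i> * ((z - cnj z) * K z (cnj z)) =
      - (F z * ((cnj z - \<i>) * K (cnj z) \<i>) + F (cnj z) * ((\<i> - z) * K \<i> z))"
    by (subst eq_neg_iff_add_eq_0) (simp only: add_ac)
  then have "cmod (F \<i> * ((z - cnj z) * K z (cnj z))) \<le>
      cmod (F z * ((cnj z - \<i>) * K (cnj z) \<i>)) + cmod (F (cnj z) * ((\<i> - z) * K \<i> z))"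
    by (metis norm_minus_cancel norm_triangle_ineq)
  then have "cmod (F \<i>) * (cmod (z - cnj z) * (U z)\<^sup>2) \<le>
      cmod (F z) * (cmod (cnj z - \<i>) * cmod (K (cnj z) \<i>)) + cmod (F z) * (cmod (\<i> - z) * cmod (K \<i> z))"
    unfolding norm_mult F_cnj K_diag complex_mod_cnj norm_of_real by simp
  also have "\<dots> \<le> cmod (F z) * ((cmod z + 1) * (U z * U \<i>)) + cmod (F z) * ((cmod z + 1) * (U \<i> * U z))"
  proof (intro add_mono mult_left_mono mult_mono)
    show "cmod (cnj z - \<i>) \<le> cmod z + 1" using norm_triangle_ineq4[of "cnj z" \<i>] by simp
    show "cmod (\<i> - z) \<le> cmod z + 1" using norm_triangle_ineq4[of \<i> z] by simp
    show "cmod (K (cnj z) \<i>) \<le> U z * U \<i>" using K_le[of "cnj z" \<i>] U_cnj by simp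
    show "cmod (K \<i> z) \<le> U \<i> * U z" by (rule K_le)
  qed auto
  \<comment> \<open>The left 2 comes from |z - cnj z| = 2 |Im z|, the right 2 from two equal bounds.
    A factor \<open>U z\<close> then cancels.\<close>
  finally have "2 * U z * (U z * \<bar>Im z\<bar> * cmod (F \<i>)) \<le> 2 * U z * (U \<i> * ((cmod z + 1) * cmod (F z)))"
    by (simp add: complex_diff_cnj norm_mult power2_eq_square algebra_simps)
  then have "U z * \<bar>Im z\<bar> * cmod (F \<i>) \<le> U \<i> * ((cmod z + 1) * cmod (F z))"
    using U_nonneg[of z] U_i by (cases "U z = 0") auto
  then show "U z * \<bar>Im z\<bar> \<le> U \<i> / cmod (F \<i>) * ((cmod z + 1) * cmod (F z))"
    using Fi by (simp add: divide_simps)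
qed

lemma L2_set_norm_triangle:
  fixes f g :: "nat \<Rightarrow> complex"
  shows "L2_set (\<lambda>k. cmod (f k + g k)) A \<le> L2_set (\<lambda>k. cmod (f k)) A + L2_set (\<lambda>k. cmod (g k)) A"
proof -
  have "L2_set (\<lambda>k. cmod (f k + g k)) A \<le> L2_set (\<lambda>k. cmod (f k) + cmod (g k)) A"
    by (intro L2_set_mono norm_triangle_ineq) auto
  also have "\<dots> \<le> L2_set (\<lambda>k. cmod (f k)) A + L2_set (\<lambda>k. cmod (g k)) A"
    by (rule L2_set_triangle_ineq)
  finally show ?thesis .
qed

lemma L2_set_sum_triangle:
  "L2_set (\<lambda>n. \<Sum>k<K. f k n) A \<le> (\<Sum>k<K. L2_set (f k) A)" for K :: nat
proof (induction K)
  case (Suc K)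
  have "L2_set (\<lambda>n. \<Sum>k<Suc K. f k n) A \<le> L2_set (\<lambda>n. \<Sum>k<K. f k n) A + L2_set (f K) A"
    using L2_set_triangle_ineq[of "\<lambda>n. \<Sum>k<K. f k n" "f K" A] by simp
  with Suc show ?case by simp
qed (simp add: L2_set_def)

section \<open>Solutions of the three-term recurrence\<close>

text \<open>The recurrence starts at index 1 and leaves the values at 0 and 1 free: polynomials of
  the first and second kind both satisfy it and differ only in these values.\<close>

definition three_term :: "(nat \<Rightarrow> real) \<Rightarrow> (nat \<Rightarrow> real) \<Rightarrow> (nat \<Rightarrow> complex \<Rightarrow> complex) \<Rightarrow> bool" where
  "three_term \<alpha> \<beta> u \<longleftrightarrow> (\<forall>n z. z * u (Suc n) z =
     \<beta> (Suc n) * u (Suc (Suc n)) z + \<alpha> (Suc n) * u (Suc n) z + \<beta> n * u n z)"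

locale jacobi_recurrence =
  fixes \<alpha> \<beta> :: "nat \<Rightarrow> real" and p q :: "nat \<Rightarrow> complex \<Rightarrow> complex"
  assumes \<beta>_pos: "\<And>n. \<beta> n > 0"
    and p_rec: "three_term \<alpha> \<beta> p" and q_rec: "three_term \<alpha> \<beta> q"
    and p_0: "\<And>z. p 0 z = 1" and p_1: "\<And>z. p (Suc 0) z = (z - \<alpha> 0) / \<beta> 0"
    and q_0: "\<And>z. q 0 z = 0" and q_1: "\<And>z. q (Suc 0) z = 1 / \<beta> 0"
begin

text \<open>The Casorati determinant weighted by \<open>\<beta> n\<close>. It takes bare sequences
  so that solutions at two different points can be paired.\<close>

definition wronskian :: "nat \<Rightarrow> (nat \<Rightarrow> complex) \<Rightarrow> (nat \<Rightarrow> complex) \<Rightarrow> complex" where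
  "wronskian n u v = complex_of_real (\<beta> n) * (u (Suc n) * v n - u n * v (Suc n))"

text \<open>The solved recurrence builds each term from its two predecessors by the operation in
  \<open>step\<close>. Used for the classes of entire functions and of functions commuting with
  conjugation.\<close>

lemma recurrence_induct:
  assumes "three_term \<alpha> \<beta> u" "u 0 \<in> X" "u (Suc 0) \<in> X"
    and step: "\<And>f g a b c. f \<in> X \<Longrightarrow> g \<in> X \<Longrightarrow> (\<lambda>z. (z * f z - complex_of_real a * f z - complex_of_real b * g z) / complex_of_real c) \<in> X"
  shows "u n \<in> X"
proof (induction n rule: induct_nat_012)
  case (ge2 n)
  have "u (Suc (Suc n)) = (\<lambda>z. (z * u (Suc n) z - \<alpha> (Suc n) * u (Suc n) z - \<beta> n * u n z) / \<beta> (Suc n))"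
  proof
    fix z
    have "z * u (Suc n) z = \<beta> (Suc n) * u (Suc (Suc n)) z + \<alpha> (Suc n) * u (Suc n) z + \<beta> n * u n z"
      using assms(1) by (simp add: three_term_def)
    moreover have "complex_of_real (\<beta> (Suc n)) \<noteq> 0" using \<beta>_pos[of "Suc n"] by simp
    ultimately show "u (Suc (Suc n)) z = (z * u (Suc n) z - \<alpha> (Suc n) * u (Suc n) z - \<beta> n * u n z) / \<beta> (Suc n)"
      by (simp add: field_simps)
  qed
  with step[OF ge2(2,1)] show ?case by metis
qed (use assms in auto)

lemma p_q_holomorphic: "p n holomorphic_on UNIV" "q n holomorphic_on UNIV"
proof -
  have step: "(\<lambda>z. (z * f z - complex_of_real a * f z - complex_of_real b * g z) / complex_of_real c) \<in> {f. f holomorphic_on UNIV}"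
    if "f \<in> {f. f holomorphic_on UNIV}" "g \<in> {f. f holomorphic_on UNIV}" for f g a b c
    using that by (cases "c = 0") (auto intro!: holomorphic_intros)
  have "p 0 = (\<lambda>z. 1)" "p (Suc 0) = (\<lambda>z. (z - complex_of_real (\<alpha> 0)) / complex_of_real (\<beta> 0))"
    "q 0 = (\<lambda>z. 0)" "q (Suc 0) = (\<lambda>z. 1 / complex_of_real (\<beta> 0))"
    by (auto simp: p_0 p_1 q_0 q_1)
  moreover have "(\<lambda>z. (z - complex_of_real (\<alpha> 0)) / complex_of_real (\<beta> 0)) holomorphic_on UNIV"
    using \<beta>_pos[of 0] by (intro holomorphic_intros) auto
  ultimately have p: "p 0 \<in> {f. f holomorphic_on UNIV}" "p (Suc 0) \<in> {f. f holomorphic_on UNIV}"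
    and q: "q 0 \<in> {f. f holomorphic_on UNIV}" "q (Suc 0) \<in> {f. f holomorphic_on UNIV}" by simp_all
  have "p n \<in> {f. f holomorphic_on UNIV}" by (rule recurrence_induct[OF p_rec p step])
  moreover have "q n \<in> {f. f holomorphic_on UNIV}" by (rule recurrence_induct[OF q_rec q step])
  ultimately show "p n holomorphic_on UNIV" "q n holomorphic_on UNIV" by auto
qed

lemma p_q_cnj: "p n (cnj z) = cnj (p n z)" "q n (cnj z) = cnj (q n z)"
proof -
  have "p n \<in> {f. \<forall>z. f (cnj z) = cnj (f z)}"
    by (rule recurrence_induct[OF p_rec]) (auto simp: p_0 p_1)
  moreover have "q n \<in> {f. \<forall>z. f (cnj z) = cnj (f z)}"
    by (rule recurrence_induct[OF q_rec]) (auto simp: q_0 q_1)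
  ultimately show "p n (cnj z) = cnj (p n z)" "q n (cnj z) = cnj (q n z)" by auto
qed

text \<open>Telescoping: from \<open>n\<close> to \<open>Suc n\<close> the \<alpha> terms cancel and
  the Wronskian grows by \<open>(a - b) * (u (Suc n) a * v (Suc n) b)\<close>. The first increment
  has index 1, hence the correction that removes the term of index 0.\<close>

lemma christoffel_darboux:
  assumes "three_term \<alpha> \<beta> u" "three_term \<alpha> \<beta> v"
  shows "wronskian n (\<lambda>k. u k a) (\<lambda>k. v k b) = wronskian 0 (\<lambda>k. u k a) (\<lambda>k. v k b)
           - (a - b) * (u 0 a * v 0 b) + (a - b) * (\<Sum>k<Suc n. u k a * v k b)"
proof (induction n)
  case (Suc n)
  have "wronskian (Suc n) (\<lambda>k. u k a) (\<lambda>k. v k b) =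
      (\<beta> (Suc n) * u (Suc (Suc n)) a) * v (Suc n) b - u (Suc n) a * (\<beta> (Suc n) * v (Suc (Suc n)) b)"
    by (simp add: wronskian_def algebra_simps)
  also have "\<beta> (Suc n) * u (Suc (Suc n)) a = a * u (Suc n) a - \<alpha> (Suc n) * u (Suc n) a - \<beta> n * u n a"
    using assms(1) by (simp add: three_term_def algebra_simps)
  also have "\<beta> (Suc n) * v (Suc (Suc n)) b = b * v (Suc n) b - \<alpha> (Suc n) * v (Suc n) b - \<beta> n * v n b"
    using assms(2) by (simp add: three_term_def algebra_simps)
  also have "(a * u (Suc n) a - \<alpha> (Suc n) * u (Suc n) a - \<beta> n * u n a) * v (Suc n) b
      - u (Suc n) a * (b * v (Suc n) b - \<alpha> (Suc n) * v (Suc n) b - \<beta> n * v n b)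
      = wronskian n (\<lambda>k. u k a) (\<lambda>k. v k b) + (a - b) * (u (Suc n) a * v (Suc n) b)"
    by (simp add: wronskian_def algebra_simps)
  finally show ?case by (simp add: Suc algebra_simps)
qed simp

text \<open>The initial values decide the constants. For \<open>p\<close> with \<open>p\<close> the
  Wronskian of index 0 is \<open>a - b\<close> and cancels the correction; in the other cases the
  product of the values at index 0 vanishes.\<close>

lemma wronskian_p_q:
  "wronskian n (\<lambda>k. p k a) (\<lambda>k. p k b) = (a - b) * (\<Sum>k<Suc n. p k a * p k b)"
  "wronskian n (\<lambda>k. p k a) (\<lambda>k. q k b) = - 1 + (a - b) * (\<Sum>k<Suc n. p k a * q k b)"
  "wronskian n (\<lambda>k. q k a) (\<lambda>k. p k b) = 1 + (a - b) * (\<Sum>k<Suc n. q k a * p k b)"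
  "wronskian n (\<lambda>k. q k a) (\<lambda>k. q k b) = (a - b) * (\<Sum>k<Suc n. q k a * q k b)"
proof -
  have b: "complex_of_real (\<beta> 0) \<noteq> 0" using \<beta>_pos[of 0] by simp
  have "(a - \<alpha> 0) / \<beta> 0 - (b - \<alpha> 0) / \<beta> 0 = (a - b) / \<beta> 0"
    by (simp add: diff_divide_distrib)
  then have "wronskian 0 (\<lambda>k. p k a) (\<lambda>k. p k b) = a - b"
    using b by (simp add: wronskian_def p_0 p_1)
  then show "wronskian n (\<lambda>k. p k a) (\<lambda>k. p k b) = (a - b) * (\<Sum>k<Suc n. p k a * p k b)"
    using christoffel_darboux[OF p_rec p_rec, of n a b] by (simp only: p_0) simp
  have "wronskian 0 (\<lambda>k. p k a) (\<lambda>k. q k b) = - 1"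
    using b by (simp add: wronskian_def p_0 q_0 q_1)
  then show "wronskian n (\<lambda>k. p k a) (\<lambda>k. q k b) = - 1 + (a - b) * (\<Sum>k<Suc n. p k a * q k b)"
    using christoffel_darboux[OF p_rec q_rec, of n a b] by (simp only: q_0) simp
  have "wronskian 0 (\<lambda>k. q k a) (\<lambda>k. p k b) = 1"
    using b by (simp add: wronskian_def p_0 q_0 q_1)
  then show "wronskian n (\<lambda>k. q k a) (\<lambda>k. p k b) = 1 + (a - b) * (\<Sum>k<Suc n. q k a * p k b)"
    using christoffel_darboux[OF q_rec p_rec, of n a b] by (simp only: q_0) simp
  have "wronskian 0 (\<lambda>k. q k a) (\<lambda>k. q k b) = 0"
    by (simp add: wronskian_def q_0)
  then show "wronskian n (\<lambda>k. q k a) (\<lambda>k. q k b) = (a - b) * (\<Sum>k<Suc n. q k a * q k b)"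
    using christoffel_darboux[OF q_rec q_rec, of n a b] by (simp only: q_0) simp
qed

text \<open>The Pluecker relation between the 2x2 minors of a 2x4 matrix.\<close>

lemma wronskian_plucker:
  "wronskian n u v * wronskian n x y = wronskian n u x * wronskian n v y - wronskian n u y * wronskian n v x"
  by (simp add: wronskian_def algebra_simps)


end

section \<open>Propagation of square summability from one point to the plane\<close>

lemma discrete_gronwall:
  fixes a x :: "nat \<Rightarrow> real"
  assumes "\<And>n. a n \<ge> 0" "h \<ge> 0" and x: "\<And>n. x n \<le> a n * (1 + h * (\<Sum>k<n. a k * x k))"
  shows "x n \<le> a n * exp (h * (\<Sum>k<n. (a k)\<^sup>2))"
proof -
  \<comment> \<open>The induction runs over the bracket rather than over \<open>x\<close>: each step
    multiplies its bound by 1 + h (a n)^2, which is at most the exponential of h (a n)^2.\<close>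
  have "1 + h * (\<Sum>k<n. a k * x k) \<le> exp (h * (\<Sum>k<n. (a k)\<^sup>2))" for n
  proof (induction n)
    case (Suc n)
    define T where "T = 1 + h * (\<Sum>k<n. a k * x k)"
    have "h * (a n * x n) \<le> h * (a n * (a n * T))"
      unfolding T_def using assms by (intro mult_left_mono) auto
    then have "1 + h * (\<Sum>k<Suc n. a k * x k) \<le> (1 + h * (a n)\<^sup>2) * T"
      by (simp add: T_def algebra_simps power2_eq_square)
    also have "\<dots> \<le> (1 + h * (a n)\<^sup>2) * exp (h * (\<Sum>k<n. (a k)\<^sup>2))"
      using Suc assms by (intro mult_left_mono) (auto simp: T_def)
    also have "\<dots> \<le> exp (h * (a n)\<^sup>2) * exp (h * (\<Sum>k<n. (a k)\<^sup>2))"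
      by (intro mult_right_mono exp_ge_add_one_self) auto
    finally show ?case by (simp add: exp_add[symmetric] algebra_simps)
  qed simp
  from mult_left_mono[OF this assms(1)] x[of n] show ?thesis by (meson order_trans)
qed

text \<open>Indeterminacy enters only through a single point of square summability.\<close>

locale indeterminate_recurrence = jacobi_recurrence +
  fixes z0 :: complex
  assumes square_summable_z0: "square_summable p z0" "square_summable q z0"
begin

definition majorant :: "nat \<Rightarrow> real" where
  "majorant k = cmod (p k z0) + cmod (q k z0)"

definition majorant_sum :: real where
  "majorant_sum = (\<Sum>k. (majorant k)\<^sup>2)"

lemma majorant_nonneg: "majorant k \<ge> 0"
  by (simp add: majorant_def)

lemma summable_majorant: "summable (\<lambda>k. (majorant k)\<^sup>2)"
proof (rule summable_comparison_test')
  show "summable (\<lambda>k. 2 * ((cmod (p k z0))\<^sup>2 + (cmod (q k z0))\<^sup>2))"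
    using square_summable_z0 unfolding square_summable_def by (intro summable_mult summable_add)
  show "norm ((majorant k)\<^sup>2) \<le> 2 * ((cmod (p k z0))\<^sup>2 + (cmod (q k z0))\<^sup>2)" if "k \<ge> 0" for k
    using sum_squares_bound[of "cmod (p k z0)" "cmod (q k z0)"]
    by (simp add: majorant_def power2_sum)
qed

text \<open>Treats the four formulas of \<open>wronskian_p_q\<close> at once, with
  \<open>\<kappa>\<close> one of 0, 1 and -1.\<close>

lemma norm_wronskian_le:
  assumes "wronskian n u v = \<kappa> + h * (\<Sum>k<Suc n. u k * v k)" "cmod \<kappa> \<le> 1"
    "\<And>k. cmod (v k) \<le> majorant k"
  shows "cmod (wronskian n u v) \<le> 1 + cmod h * (\<Sum>k<Suc n. majorant k * cmod (u k))"
proof -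
  have "cmod (\<Sum>k<Suc n. u k * v k) \<le> (\<Sum>k<Suc n. majorant k * cmod (u k))"
    by (rule order_trans[OF norm_sum sum_mono])
       (use assms(3) in \<open>auto simp: norm_mult mult.commute intro: mult_left_mono\<close>)
  then have "cmod h * cmod (\<Sum>k<Suc n. u k * v k) \<le> cmod h * (\<Sum>k<Suc n. majorant k * cmod (u k))"
    by (rule mult_left_mono) simp
  moreover have "cmod (wronskian n u v) \<le> cmod \<kappa> + cmod h * cmod (\<Sum>k<Suc n. u k * v k)"
    unfolding assms(1) by (metis norm_mult norm_triangle_ineq)
  ultimately show ?thesis using assms(2) by linarith
qed

text \<open>Variation of constants: a solution at \<open>z\<close> is expanded in the two solutions at \<open>z0\<close>.\<close>

lemma solution_le_majorant:
  assumes "u = p \<or> u = q"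
  shows "cmod (u n z) \<le> majorant n * exp (cmod (z - z0) * (\<Sum>k<n. (majorant k)\<^sup>2))"
proof (rule discrete_gronwall[where x = "\<lambda>n. cmod (u n z)"])
  fix n
  show "cmod (u n z) \<le> majorant n * (1 + cmod (z - z0) * (\<Sum>k<n. majorant k * cmod (u k z)))"
  proof (cases n)
    case 0
    then show ?thesis using assms by (auto simp: majorant_def p_0 q_0)
  next
    case (Suc m)
    define T where "T = 1 + cmod (z - z0) * (\<Sum>k<Suc m. majorant k * cmod (u k z))"
    let ?x = "\<lambda>k. p k z0" and ?y = "\<lambda>k. q k z0" and ?u = "\<lambda>k. u k z"
    have le: "cmod (?x k) \<le> majorant k" "cmod (?y k) \<le> majorant k" for k
      by (auto simp: majorant_def)
    \<comment> \<open>Cramer's rule: the basis at \<open>z0\<close> has determinant -1 at every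
      index. The Wronskians with \<open>?u\<close> at index \<open>m\<close> are bounded through
      \<open>u k z\<close> with k \<le> m only, which is the form Gronwall's inequality
      requires.\<close>
    have "wronskian m ?x ?y = -1" unfolding wronskian_p_q by simp
    moreover have "u (Suc m) z * wronskian m ?x ?y =
        ?x (Suc m) * wronskian m ?u ?y - ?y (Suc m) * wronskian m ?u ?x"
      by (simp add: wronskian_def algebra_simps)
    ultimately have "u (Suc m) z = ?y (Suc m) * wronskian m ?u ?x - ?x (Suc m) * wronskian m ?u ?y"
      by (simp add: algebra_simps minus_equation_iff[of "u (Suc m) z"])
    then have "cmod (u (Suc m) z) \<le>
        cmod (?y (Suc m)) * cmod (wronskian m ?u ?x) + cmod (?x (Suc m)) * cmod (wronskian m ?u ?y)"
      by (metis norm_mult norm_triangle_ineq4)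
    also have "\<dots> \<le> cmod (?y (Suc m)) * T + cmod (?x (Suc m)) * T"
    proof (intro add_mono mult_left_mono)
      show "cmod (wronskian m ?u ?x) \<le> T"
        using assms norm_wronskian_le[OF _ _ le(1), of m ?u 0 "z - z0"] norm_wronskian_le[OF _ _ le(1), of m ?u 1 "z - z0"]
        by (auto simp: T_def wronskian_p_q)
      show "cmod (wronskian m ?u ?y) \<le> T"
        using assms norm_wronskian_le[OF _ _ le(2), of m ?u 0 "z - z0"] norm_wronskian_le[OF _ _ le(2), of m ?u "-1" "z - z0"]
        by (auto simp: T_def wronskian_p_q)
    qed auto
    finally show ?thesis by (simp add: Suc T_def majorant_def algebra_simps)
  qed
qed (auto simp: majorant_nonneg)

lemma L2_set_solution_le:
  assumes "u = p \<or> u = q"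
  shows "L2_set (\<lambda>k. cmod (u k z)) {..<N} \<le> exp (cmod (z - z0) * majorant_sum) * sqrt majorant_sum"
proof -
  let ?E = "exp (cmod (z - z0) * majorant_sum)"
  have part: "(\<Sum>k<n. (majorant k)\<^sup>2) \<le> majorant_sum" for n
    unfolding majorant_sum_def by (rule sum_le_suminf[OF summable_majorant]) auto
  have "L2_set (\<lambda>k. cmod (u k z)) {..<N} \<le> L2_set (\<lambda>k. ?E * majorant k) {..<N}"
  proof (rule L2_set_mono)
    fix k
    have "cmod (u k z) \<le> majorant k * exp (cmod (z - z0) * (\<Sum>j<k. (majorant j)\<^sup>2))"
      by (rule solution_le_majorant[OF assms])
    also have "\<dots> \<le> majorant k * ?E"
      using part by (intro mult_left_mono) (auto intro: mult_left_mono simp: majorant_nonneg)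
    finally show "cmod (u k z) \<le> ?E * majorant k" by (simp add: mult.commute)
  qed auto
  also have "\<dots> = ?E * L2_set majorant {..<N}" by (simp add: L2_set_right_distrib)
  also have "\<dots> \<le> ?E * sqrt majorant_sum"
    using part by (intro mult_left_mono) (auto simp: L2_set_def)
  finally show ?thesis .
qed

lemma square_summable: "square_summable p z" "square_summable q z"
  by (rule l2_leI(1)[OF L2_set_solution_le], simp)+

lemma locally_bounded_l2:
  assumes "u = p \<or> u = q"
  shows "locally_bounded (\<lambda>z. complex_of_real (l2 u z))"
  unfolding locally_bounded_def
proof (intro allI exI impI)
  fix r z assume "cmod z \<le> r"
  then have "cmod (z - z0) \<le> r + cmod z0" using norm_triangle_ineq4[of z z0] by simp
  moreover have "majorant_sum \<ge> 0"
    unfolding majorant_sum_def by (intro suminf_nonneg summable_majorant) auto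
  ultimately have "exp (cmod (z - z0) * majorant_sum) * sqrt majorant_sum
      \<le> exp ((r + cmod z0) * majorant_sum) * sqrt majorant_sum"
    by (auto intro!: mult_right_mono)
  moreover have "l2 u z \<le> exp (cmod (z - z0) * majorant_sum) * sqrt majorant_sum"
    by (rule l2_leI(2)[OF L2_set_solution_le[OF assms]])
  moreover have "l2 u z \<ge> 0" using assms square_summable by (auto intro: l2_nonneg)
  ultimately show "cmod (complex_of_real (l2 u z)) \<le> exp ((r + cmod z0) * majorant_sum) * sqrt majorant_sum"
    by simp
qed

section \<open>The functions A, B, C, D and the reproducing kernels\<close>

definition kernel :: "(nat \<Rightarrow> complex \<Rightarrow> complex) \<Rightarrow> complex \<Rightarrow> complex \<Rightarrow> complex" where
  "kernel u a b = (\<Sum>k. u k a * u k b)"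

definition "fA z = z * (\<Sum>k. q k 0 * q k z)"
definition "fB z = - 1 + z * (\<Sum>k. q k 0 * p k z)"
definition "fC z = 1 + z * (\<Sum>k. p k 0 * q k z)"
definition "fD z = z * (\<Sum>k. p k 0 * p k z)"

text \<open>The factors in the series are ordered so that b = 0 gives the shape of
  \<open>fA\<close>, \<open>fB\<close>, \<open>fC\<close> and \<open>fD\<close>.\<close>

lemma wronskian_tendsto:
  assumes "\<And>n. wronskian n (\<lambda>k. u k a) (\<lambda>k. v k b) = \<kappa> + (a - b) * (\<Sum>k<Suc n. u k a * v k b)"
    and "u = p \<or> u = q" "v = p \<or> v = q"
  shows "(\<lambda>n. wronskian n (\<lambda>k. u k a) (\<lambda>k. v k b)) \<longlonglongrightarrow> \<kappa> + (a - b) * (\<Sum>k. v k b * u k a)"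
proof -
  have "summable (\<lambda>k. v k b * u k a)"
    using assms(2,3) square_summable by (intro summable_mult_square_summable(1)[of v b u a]) auto
  from LIMSEQ_Suc[OF summable_LIMSEQ[OF this]]
  have "(\<lambda>n. \<Sum>k<Suc n. u k a * v k b) \<longlonglongrightarrow> (\<Sum>k. v k b * u k a)"
    by (simp only: mult.commute[of "u _ a"])
  then show ?thesis unfolding assms(1) by (intro tendsto_add tendsto_mult tendsto_const)
qed

text \<open>The Pluecker relation is applied to the solutions at \<open>a\<close>, at
  \<open>b\<close> and the two solutions at 0, whose mutual Wronskian is -1. As the index tends to
  infinity, Wronskians against solutions at 0 tend to A, B, C, D, and those between \<open>a\<close>
  and \<open>b\<close> to the kernel times \<open>a - b\<close>.\<close>

lemma kernel_identity:
  "(a - b) * kernel p a b = fB a * fD b - fD a * fB b"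
  "(a - b) * kernel q a b = fA a * fC b - fC a * fA b"
proof -
  have pq: "wronskian n (\<lambda>k. p k 0) (\<lambda>k. q k 0) = -1" for n unfolding wronskian_p_q by simp
  have D: "(\<lambda>n. wronskian n (\<lambda>k. p k a) (\<lambda>k. p k 0)) \<longlonglongrightarrow> fD a" for a
    using wronskian_tendsto[of p a p 0 0] by (simp add: wronskian_p_q fD_def)
  have B: "(\<lambda>n. wronskian n (\<lambda>k. p k a) (\<lambda>k. q k 0)) \<longlonglongrightarrow> fB a" for a
    using wronskian_tendsto[of p a q 0 "-1"] by (simp add: wronskian_p_q fB_def)
  have C: "(\<lambda>n. wronskian n (\<lambda>k. q k a) (\<lambda>k. p k 0)) \<longlonglongrightarrow> fC a" for a
    using wronskian_tendsto[of q a p 0 1] by (simp add: wronskian_p_q fC_def)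
  have A: "(\<lambda>n. wronskian n (\<lambda>k. q k a) (\<lambda>k. q k 0)) \<longlonglongrightarrow> fA a" for a
    using wronskian_tendsto[of q a q 0 0] by (simp add: wronskian_p_q fA_def)
  have pp: "(\<lambda>n. wronskian n (\<lambda>k. p k a) (\<lambda>k. p k b)) \<longlonglongrightarrow> (a - b) * kernel p a b"
    using wronskian_tendsto[of p a p b 0] by (simp add: wronskian_p_q kernel_def mult.commute)
  have qq: "(\<lambda>n. wronskian n (\<lambda>k. q k a) (\<lambda>k. q k b)) \<longlonglongrightarrow> (a - b) * kernel q a b"
    using wronskian_tendsto[of q a q b 0] by (simp add: wronskian_p_q kernel_def mult.commute)
  have "wronskian n (\<lambda>k. p k a) (\<lambda>k. p k b) =
     wronskian n (\<lambda>k. p k a) (\<lambda>k. q k 0) * wronskian n (\<lambda>k. p k b) (\<lambda>k. p k 0)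
     - wronskian n (\<lambda>k. p k a) (\<lambda>k. p k 0) * wronskian n (\<lambda>k. p k b) (\<lambda>k. q k 0)" for n
    using wronskian_plucker[of n "\<lambda>k. p k a" "\<lambda>k. p k b" "\<lambda>k. p k 0" "\<lambda>k. q k 0"]
    by (simp add: pq algebra_simps minus_equation_iff)
  then have "(\<lambda>n. wronskian n (\<lambda>k. p k a) (\<lambda>k. p k b)) \<longlonglongrightarrow> fB a * fD b - fD a * fB b"
    by (simp only:) (intro tendsto_diff tendsto_mult A B C D)
  with pp show "(a - b) * kernel p a b = fB a * fD b - fD a * fB b" by (rule LIMSEQ_unique)
  have "wronskian n (\<lambda>k. q k a) (\<lambda>k. q k b) =
     wronskian n (\<lambda>k. q k a) (\<lambda>k. q k 0) * wronskian n (\<lambda>k. q k b) (\<lambda>k. p k 0)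
     - wronskian n (\<lambda>k. q k a) (\<lambda>k. p k 0) * wronskian n (\<lambda>k. q k b) (\<lambda>k. q k 0)" for n
    using wronskian_plucker[of n "\<lambda>k. q k a" "\<lambda>k. q k b" "\<lambda>k. p k 0" "\<lambda>k. q k 0"]
    by (simp add: pq algebra_simps minus_equation_iff)
  then have "(\<lambda>n. wronskian n (\<lambda>k. q k a) (\<lambda>k. q k b)) \<longlonglongrightarrow> fA a * fC b - fC a * fA b"
    by (simp only:) (intro tendsto_diff tendsto_mult A B C D)
  with qq show "(a - b) * kernel q a b = fA a * fC b - fC a * fA b" by (rule LIMSEQ_unique)
qed

lemma series_cnj:
  assumes "u = p \<or> u = q" "v = p \<or> v = q"
  shows "(\<Sum>k. u k 0 * v k (cnj z)) = cnj (\<Sum>k. u k 0 * v k z)"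
proof -
  have "summable (\<lambda>k. u k 0 * v k z)"
    using assms square_summable by (intro summable_mult_square_summable(1)[of u 0 v z]) auto
  from bounded_linear.suminf[OF bounded_linear_cnj this] show ?thesis
    using assms p_q_cnj(1)[of _ 0] p_q_cnj(2)[of _ 0] by (auto simp: p_q_cnj)
qed

lemma fABCD_cnj: "fA (cnj z) = cnj (fA z)" "fB (cnj z) = cnj (fB z)" "fC (cnj z) = cnj (fC z)" "fD (cnj z) = cnj (fD z)"
  by (simp_all add: fA_def fB_def fC_def fD_def series_cnj)

lemma l2_p_ge: "l2 p z \<ge> 1"
  using norm_le_l2[OF square_summable(1), of 0 z] by (simp add: p_0)

text \<open>As \<open>q 0\<close> vanishes, the bound comes from the constant \<open>q 1\<close>.
  Such positive lower bounds let \<open>l2\<close> absorb additive constants.\<close>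

lemma l2_q_ge: "l2 q z \<ge> 1 / \<beta> 0"
  using norm_le_l2[OF square_summable(2), of "Suc 0" z] \<beta>_pos[of 0] by (simp add: q_1 norm_divide)

text \<open>Cauchy-Schwarz; the constant \<open>\<kappa>\<close> lets one statement serve A, B, C
  and D.\<close>

lemma growth_le_l2:
  assumes "u = p \<or> u = q" "v = p \<or> v = q" "cmod \<kappa> \<le> 1"
  shows "growth_le (\<lambda>z. \<kappa> + z * (\<Sum>k. u k 0 * v k z)) (\<lambda>z. complex_of_real (l2 v z))"
    "locally_bounded (\<lambda>z. \<kappa> + z * (\<Sum>k. u k 0 * v k z))"
proof -
  let ?M = "max_modulus (\<lambda>z. complex_of_real (l2 v z))"
  have sv: "square_summable v z" and su: "square_summable u z" for z using assms square_summable by auto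
  have *: "cmod (\<kappa> + z * (\<Sum>k. u k 0 * v k z)) \<le> 1 + r * (l2 u 0 * l2 v z)" if "cmod z \<le> r" for z r
  proof -
    have "cmod (\<kappa> + z * (\<Sum>k. u k 0 * v k z)) \<le> 1 + cmod z * cmod (\<Sum>k. u k 0 * v k z)"
      using norm_triangle_ineq[of \<kappa> "z * (\<Sum>k. u k 0 * v k z)"] assms(3) by (simp add: norm_mult)
    also have "cmod z * cmod (\<Sum>k. u k 0 * v k z) \<le> r * (l2 u 0 * l2 v z)"
      using that summable_mult_square_summable(2)[OF su sv] order_trans[OF norm_ge_zero that]
      by (intro mult_mono) auto
    finally show ?thesis by simp
  qed
  have M: "l2 v z \<le> ?M r" if "cmod z \<le> r" for z r
    using locally_bounded_norm_le_max_modulus[OF locally_bounded_l2[OF assms(2)] that] by simp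
  show "locally_bounded (\<lambda>z. \<kappa> + z * (\<Sum>k. u k 0 * v k z))"
    unfolding locally_bounded_def
  proof (intro allI exI impI)
    fix r z assume z: "cmod z \<le> r"
    have "r * (l2 u 0 * l2 v z) \<le> r * (l2 u 0 * ?M r)"
      using M[OF z] order_trans[OF norm_ge_zero z] l2_nonneg[OF su] by (intro mult_left_mono) auto
    then show "cmod (\<kappa> + z * (\<Sum>k. u k 0 * v k z)) \<le> 1 + r * (l2 u 0 * ?M r)" using *[OF z] by linarith
  qed
  obtain l where l: "l > 0" "\<And>z. l2 v z \<ge> l"
    using assms(2) l2_p_ge l2_q_ge \<beta>_pos[of 0] by (metis zero_less_divide_1_iff zero_less_one)
  show "growth_le (\<lambda>z. \<kappa> + z * (\<Sum>k. u k 0 * v k z)) (\<lambda>z. complex_of_real (l2 v z))"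
  proof (rule growth_leI[where L=1 and k=1 and C="1 / l + l2 u 0"])
    fix r z assume r: "1 \<le> r" and z: "cmod z \<le> r"
    \<comment> \<open>Absorbs the bound 1 for \<open>\<kappa>\<close> by means of the lower bound
      \<open>l\<close> of \<open>l2 v\<close>.\<close>
    have 1: "1 \<le> r * (1 / l * ?M r)"
    proof -
      have "1 \<le> 1 / l * ?M r" using l(1) order_trans[OF l(2) M[OF z]] by (simp add: divide_simps)
      from mult_mono[OF r this] r show ?thesis by simp
    qed
    have "r * (l2 u 0 * l2 v z) \<le> r * (l2 u 0 * ?M r)"
      using M[OF z] r l2_nonneg[OF su] by (intro mult_left_mono) auto
    then show "cmod (\<kappa> + z * (\<Sum>k. u k 0 * v k z)) \<le> (1 / l + l2 u 0) * r ^ 1 * ?M (1 * r)"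
      using *[OF z] 1 by (simp add: algebra_simps)
  qed (use l l2_nonneg[OF su] in \<open>auto intro: add_pos_nonneg\<close>)
qed

lemma l2_growth_le:
  assumes u: "u = p \<or> u = q" and "locally_bounded F" and "c > 0"
    and *: "\<And>z. l2 u z * \<bar>Im z\<bar> \<le> c * ((cmod z + 1) * cmod (F z))"
  shows "growth_le (\<lambda>z. complex_of_real (l2 u z)) F"
proof (rule growth_leI[where L=3 and k=2 and C="12 * c"])
  fix r z assume r: "1 \<le> r" and z: "cmod z \<le> r"
  let ?M = "max_modulus F (3 * r)"
  have su: "square_summable u z" for z using u square_summable by auto
  have "L2_set (\<lambda>k. cmod (u k z)) {..<N} \<le> 12 * c * r\<^sup>2 * ?M" for N
  proof (rule L2_set_bound_across_real_axis[OF _ _ z])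
    show "u k holomorphic_on UNIV" for k using u p_q_holomorphic by auto
    fix \<zeta> assume \<zeta>: "cmod \<zeta> \<le> r + 2" "Im \<zeta> \<noteq> 0"
    have M: "cmod (F \<zeta>) \<le> ?M"
      using assms(2) by (rule locally_bounded_norm_le_max_modulus) (use \<zeta> r in auto)
    have im: "\<bar>Im \<zeta>\<bar> \<le> 3 * r" using abs_Im_le_cmod[of \<zeta>] \<zeta> r by linarith
    have "L2_set (\<lambda>k. cmod (u k \<zeta>)) {..<N} * (Im \<zeta>)\<^sup>2 \<le> l2 u \<zeta> * (Im \<zeta>)\<^sup>2"
      using L2_set_le_l2[OF su] by (intro mult_right_mono) auto
    also have "\<dots> = (l2 u \<zeta> * \<bar>Im \<zeta>\<bar>) * \<bar>Im \<zeta>\<bar>" by (simp add: power2_eq_square abs_mult_self_eq)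
    also have "\<dots> \<le> (c * ((cmod \<zeta> + 1) * cmod (F \<zeta>))) * \<bar>Im \<zeta>\<bar>"
      by (intro mult_right_mono *) auto
    \<comment> \<open>Here r + 2 \<le> 3 r, so |\<zeta>| + 1 \<le> 4 r. The factor 3 r is the price
      for a second power of |Im \<zeta>|, as the maximum principle above is stated with the
      square.\<close>
    also have "\<dots> \<le> (c * ((4 * r) * ?M)) * (3 * r)"
      using M \<zeta> r assms(3) im order_trans[OF norm_ge_zero M] by (intro mult_mono) auto
    finally show "L2_set (\<lambda>k. cmod (u k \<zeta>)) {..<N} * (Im \<zeta>)\<^sup>2 \<le> 12 * c * r\<^sup>2 * ?M"
      by (simp add: power2_eq_square mult_ac)
  qed
  from l2_leI(2)[of u z, OF this] show "cmod (complex_of_real (l2 u z)) \<le> 12 * c * r\<^sup>2 * ?M"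
    using l2_nonneg[OF su] by simp
qed (use assms in auto)

text \<open>The remaining hypotheses of \<open>kernel_diagonal_bound\<close>, in the order in which
  it takes them.\<close>

lemma kernel_bounds:
  assumes u: "u = p \<or> u = q"
  shows "l2 u (cnj z) = l2 u z" "cmod (kernel u a b) \<le> l2 u a * l2 u b"
    "kernel u z (cnj z) = complex_of_real ((l2 u z)\<^sup>2)" "l2 u z \<ge> 0" "l2 u \<i> > 0"
proof -
  have su: "square_summable u z" for z using u square_summable by auto
  have cn: "u k (cnj z) = cnj (u k z)" for k z using u p_q_cnj by auto
  show "l2 u (cnj z) = l2 u z" by (simp add: l2_def cn)
  show "cmod (kernel u a b) \<le> l2 u a * l2 u b"
    unfolding kernel_def by (rule summable_mult_square_summable[OF su su])
  show "kernel u z (cnj z) = complex_of_real ((l2 u z)\<^sup>2)"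
    unfolding kernel_def l2_power2[OF su] cn complex_norm_square[symmetric]
    using su[of z] by (simp add: square_summable_def suminf_of_real)
  show "l2 u z \<ge> 0" by (rule l2_nonneg[OF su])
  show "l2 u \<i> > 0"
    using u l2_p_ge[of \<i>] l2_q_ge[of \<i>] \<beta>_pos[of 0] by (auto intro: less_le_trans[rotated])
qed

lemma growth_equivalences:
  "growth_le fA (\<lambda>z. complex_of_real (l2 q z))" "growth_le (\<lambda>z. complex_of_real (l2 q z)) fA"
  "growth_le fB (\<lambda>z. complex_of_real (l2 p z))" "growth_le (\<lambda>z. complex_of_real (l2 p z)) fB"
  "growth_le fC (\<lambda>z. complex_of_real (l2 q z))" "growth_le (\<lambda>z. complex_of_real (l2 q z)) fC"
  "growth_le fD (\<lambda>z. complex_of_real (l2 p z))" "growth_le (\<lambda>z. complex_of_real (l2 p z)) fD"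
proof -
  have eq: "fA = (\<lambda>z. 0 + z * (\<Sum>k. q k 0 * q k z))" "fB = (\<lambda>z. - 1 + z * (\<Sum>k. q k 0 * p k z))"
    "fC = (\<lambda>z. 1 + z * (\<Sum>k. p k 0 * q k z))" "fD = (\<lambda>z. 0 + z * (\<Sum>k. p k 0 * p k z))"
    by (auto simp: fA_def fB_def fC_def fD_def)
  show "growth_le fA (\<lambda>z. complex_of_real (l2 q z))" "growth_le fB (\<lambda>z. complex_of_real (l2 p z))"
    "growth_le fC (\<lambda>z. complex_of_real (l2 q z))" "growth_le fD (\<lambda>z. complex_of_real (l2 p z))"
    unfolding eq by (rule growth_le_l2; simp)+
  have lb: "locally_bounded fA" "locally_bounded fB" "locally_bounded fC" "locally_bounded fD"
    unfolding eq by (rule growth_le_l2; simp)+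
  have low: "growth_le (\<lambda>z. complex_of_real (l2 u z)) F"
    if u: "u = p \<or> u = q" and F: "locally_bounded F" "\<And>z. F (cnj z) = cnj (F z)"
    and id: "\<And>a b. (a - b) * kernel u a b = F a * G b - G a * F b" for u F G
  proof -
    note bound = kernel_diagonal_bound[OF id F(2) kernel_bounds[OF u]]
    show ?thesis
      by (rule l2_growth_le[OF u F(1) _ bound(2)]) (use bound(1) kernel_bounds(5)[OF u] in simp)
  qed
  show "growth_le (\<lambda>z. complex_of_real (l2 q z)) fA"
    by (rule low[of q fA fC, OF _ lb(1) fABCD_cnj(1)]) (auto simp: kernel_identity)
  show "growth_le (\<lambda>z. complex_of_real (l2 p z)) fB"
    by (rule low[of p fB fD, OF _ lb(2) fABCD_cnj(2)]) (auto simp: kernel_identity)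
  \<comment> \<open>The kernel identity is antisymmetric in the two functions, so exchanging their
    roles puts a minus sign on the partner.\<close>
  show "growth_le (\<lambda>z. complex_of_real (l2 q z)) fC"
    by (rule low[of q fC "\<lambda>z. - fA z", OF _ lb(3) fABCD_cnj(3)]) (auto simp: kernel_identity)
  show "growth_le (\<lambda>z. complex_of_real (l2 p z)) fD"
    by (rule low[of p fD "\<lambda>z. - fB z", OF _ lb(4) fABCD_cnj(4)]) (auto simp: kernel_identity)
qed

text \<open>The vector w p + q is small by Bessel's inequality. Hence q is controlled by p through
  the upper bound on \<open>w\<close>, and p by q through the lower bound, which costs a further
  factor (1 + |z|)^2 / |Im z|.\<close>

lemma growth_p_q:
  assumes "c > 0"
    and w_le: "\<And>z. Im z \<noteq> 0 \<Longrightarrow> cmod (w z) * \<bar>Im z\<bar> \<le> 1"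
    and w_ge: "\<And>z. Im z \<noteq> 0 \<Longrightarrow> c * \<bar>Im z\<bar> \<le> cmod (w z) * (1 + cmod z)\<^sup>2"
    and bessel: "\<And>z N. Im z \<noteq> 0 \<Longrightarrow> L2_set (\<lambda>k. cmod (w z * p k z + q k z)) {..<N} * \<bar>Im z\<bar> \<le> 1"
  shows "growth_le (\<lambda>z. complex_of_real (l2 p z)) (\<lambda>z. complex_of_real (l2 q z))"
    "growth_le (\<lambda>z. complex_of_real (l2 q z)) (\<lambda>z. complex_of_real (l2 p z))"
proof -
  let ?P = "max_modulus (\<lambda>z. complex_of_real (l2 p z))" and ?Q = "max_modulus (\<lambda>z. complex_of_real (l2 q z))"
  define b where "b = \<beta> 0"
  have b: "b > 0" using \<beta>_pos by (simp add: b_def)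
  have P: "l2 p z \<le> ?P r" "1 \<le> ?P r" if "cmod z \<le> r" for z r
    using locally_bounded_norm_le_max_modulus[OF locally_bounded_l2 that, of p] l2_p_ge[of z] by simp_all
  have Q: "l2 q z \<le> ?Q r" "1 \<le> b * ?Q r" if "cmod z \<le> r" for z r
  proof -
    show *: "l2 q z \<le> ?Q r"
      using locally_bounded_norm_le_max_modulus[OF locally_bounded_l2 that, of q] by simp
    have "1 / b \<le> ?Q r" using l2_q_ge[of z] * by (simp add: b_def)
    then show "1 \<le> b * ?Q r" using b by (simp add: field_simps)
  qed
  let ?L = "\<lambda>u z N. L2_set (\<lambda>k. cmod (u k z)) {..<N}"
  have w_L: "L2_set (\<lambda>k. cmod (w z * p k z)) {..<N} = cmod (w z) * ?L p z N" for z N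
    by (simp add: norm_mult L2_set_right_distrib)
  have Lq: "?L q z N * (Im z)\<^sup>2 \<le> 6 * r * ?P (3 * r)"
    if r: "1 \<le> r" and z: "cmod z \<le> r + 2" "Im z \<noteq> 0" for r z N
  proof -
    have z3: "cmod z \<le> 3 * r" using z r by simp
    have im: "\<bar>Im z\<bar> \<le> 3 * r" using abs_Im_le_cmod[of z] z3 by linarith
    have "?L q z N \<le> L2_set (\<lambda>k. cmod (w z * p k z + q k z)) {..<N} + cmod (w z) * ?L p z N"
      using L2_set_norm_triangle[of "\<lambda>k. w z * p k z + q k z" "\<lambda>k. - (w z * p k z)" "{..<N}"] by (simp add: w_L)
    from mult_right_mono[OF this, of "\<bar>Im z\<bar>"] have "?L q z N * \<bar>Im z\<bar> \<le> L2_set (\<lambda>k. cmod (w z * p k z + q k z)) {..<N} * \<bar>Im z\<bar> + cmod (w z) * \<bar>Im z\<bar> * ?L p z N"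
      by (simp add: algebra_simps)
    also have "\<dots> \<le> 1 + 1 * ?L p z N"
      by (intro add_mono bessel w_le z mult_right_mono) auto
    also have "\<dots> \<le> 2 * ?P (3 * r)"
      using P[OF z3] L2_set_le_l2[OF square_summable(1), of z N] by simp
    finally have *: "?L q z N * \<bar>Im z\<bar> \<le> 2 * ?P (3 * r)" .
    have "?L q z N * \<bar>Im z\<bar> * \<bar>Im z\<bar> \<le> (2 * ?P (3 * r)) * (3 * r)"
      by (rule mult_mono[OF * im]) (use P(2)[OF z3] in auto)
    then show ?thesis by (simp add: power2_eq_square abs_mult_self_eq mult.assoc mult.commute[of r])
  qed
  have Lp: "?L p z N * (Im z)\<^sup>2 \<le> 16 * (3 + b) / c * r ^ 3 * ?Q (3 * r)"
    if r: "1 \<le> r" and z: "cmod z \<le> r + 2" "Im z \<noteq> 0" for r z N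
  proof -
    have z3: "cmod z \<le> 3 * r" using z r by simp
    have im: "\<bar>Im z\<bar> \<le> 3 * r" using abs_Im_le_cmod[of z] z3 by linarith
    have Q0: "?Q (3 * r) \<ge> 0" using Q(1)[OF z3] l2_nonneg[OF square_summable(2), of z] by linarith
    have "cmod (w z) * ?L p z N \<le> L2_set (\<lambda>k. cmod (w z * p k z + q k z)) {..<N} + ?L q z N"
      using L2_set_norm_triangle[of "\<lambda>k. w z * p k z + q k z" "\<lambda>k. - q k z" "{..<N}"] by (simp add: w_L)
    from mult_right_mono[OF this, of "\<bar>Im z\<bar>"] have "cmod (w z) * ?L p z N * \<bar>Im z\<bar> \<le> L2_set (\<lambda>k. cmod (w z * p k z + q k z)) {..<N} * \<bar>Im z\<bar> + ?L q z N * \<bar>Im z\<bar>"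
      by (simp add: algebra_simps)
    also have "\<dots> \<le> r * (b * ?Q (3 * r)) + ?Q (3 * r) * (3 * r)"
    proof (rule add_mono)
      \<comment> \<open>The constant 1 of Bessel's inequality is absorbed using 1 \<le> r and the
        lower bound for \<open>l2 q\<close>.\<close>
      show "L2_set (\<lambda>k. cmod (w z * p k z + q k z)) {..<N} * \<bar>Im z\<bar> \<le> r * (b * ?Q (3 * r))"
        using bessel[OF z(2), of N] mult_mono[OF r Q(2)[OF z3]] r by simp
      have "?L q z N \<le> ?Q (3 * r)" using Q(1)[OF z3] L2_set_le_l2[OF square_summable(2), of z N] by simp
      then show "?L q z N * \<bar>Im z\<bar> \<le> ?Q (3 * r) * (3 * r)"
        by (rule mult_mono) (use im Q0 in auto)
    qed
    finally have 1: "cmod (w z) * ?L p z N * \<bar>Im z\<bar> \<le> (3 + b) * r * ?Q (3 * r)" by (simp add: algebra_simps)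
    \<comment> \<open>One factor |Im z| pays for the lower bound on \<open>w\<close>, the other for
      Bessel's inequality.\<close>
    have "c * (?L p z N * (Im z)\<^sup>2) = (c * \<bar>Im z\<bar>) * (?L p z N * \<bar>Im z\<bar>)"
      by (simp add: power2_eq_square abs_mult_self_eq)
    also have "\<dots> \<le> (cmod (w z) * (1 + cmod z)\<^sup>2) * (?L p z N * \<bar>Im z\<bar>)"
      by (intro mult_right_mono w_ge z) auto
    also have "\<dots> = (1 + cmod z)\<^sup>2 * (cmod (w z) * ?L p z N * \<bar>Im z\<bar>)" by simp
    also have "\<dots> \<le> (4 * r)\<^sup>2 * ((3 + b) * r * ?Q (3 * r))"
      by (rule mult_mono[OF power_mono 1]) (use z3 r in auto)
    finally have "c * (?L p z N * (Im z)\<^sup>2) \<le> 16 * (3 + b) * r ^ 3 * ?Q (3 * r)"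
      by (simp add: power2_eq_square power3_eq_cube algebra_simps)
    then show ?thesis using assms(1) by (simp add: field_simps)
  qed
  show "growth_le (\<lambda>z. complex_of_real (l2 q z)) (\<lambda>z. complex_of_real (l2 p z))"
  proof (rule growth_leI[where L=3 and k=1 and C=6])
    fix r z assume r: "1 \<le> r" and z: "cmod z \<le> r"
    have "?L q z N \<le> 6 * r * ?P (3 * r)" for N
      by (rule L2_set_bound_across_real_axis[OF p_q_holomorphic(2) Lq[OF r] z])
    from l2_leI(2)[of q z, OF this] show "cmod (complex_of_real (l2 q z)) \<le> 6 * r ^ 1 * ?P (3 * r)"
      using l2_nonneg[OF square_summable(2)] by simp
  qed auto
  show "growth_le (\<lambda>z. complex_of_real (l2 p z)) (\<lambda>z. complex_of_real (l2 q z))"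
  proof (rule growth_leI[where L=3 and k=3 and C="16 * (3 + b) / c"])
    fix r z assume r: "1 \<le> r" and z: "cmod z \<le> r"
    have "?L p z N \<le> 16 * (3 + b) / c * r ^ 3 * ?Q (3 * r)" for N
      by (rule L2_set_bound_across_real_axis[OF p_q_holomorphic(1) Lp[OF r] z])
    from l2_leI(2)[of p z, OF this] show "cmod (complex_of_real (l2 p z)) \<le> 16 * (3 + b) / c * r ^ 3 * ?Q (3 * r)"
      using l2_nonneg[OF square_summable(1)] by simp
  qed (use assms(1) b in auto)
qed

end

section \<open>The coefficient function\<close>

lemma higher_deriv_poly: "(deriv ^^ k) (poly Q) z = poly ((pderiv ^^ k) Q) z" for Q :: "complex poly"
proof (induction k arbitrary: z)
  case (Suc k)
  then have "(deriv ^^ k) (poly Q) = poly ((pderiv ^^ k) Q)" by blast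
  then show ?case by (simp add: DERIV_imp_deriv[OF poly_DERIV])
qed simp

lemma norm_coeff_le:
  fixes Q :: "complex poly"
  assumes "R > 0" "\<And>z. cmod z = R \<Longrightarrow> cmod (poly Q z) \<le> B"
  shows "cmod (coeff Q k) \<le> B / R ^ k"
proof -
  have "norm ((deriv ^^ k) (poly Q) 0) \<le> fact k * B / R ^ k"
    by (rule Cauchy_inequality) (use assms in \<open>auto intro!: holomorphic_intros continuous_intros\<close>)
  moreover have "(deriv ^^ k) (poly Q) 0 = fact k * coeff Q k"
    by (simp add: higher_deriv_poly poly_0_coeff_0 coeff_higher_pderiv pochhammer_fact)
  ultimately have "fact k * cmod (coeff Q k) \<le> fact k * (B / R ^ k)" by (simp add: norm_mult)
  then show ?thesis by (rule mult_left_le_imp_le) simp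
qed

lemma cpoly_eq_sum: "degree q < N \<Longrightarrow> cpoly q z = (\<Sum>k<N. of_real (coeff q k) * z ^ k)"
proof -
  assume "degree q < N"
  then have "(\<Sum>k\<le>degree q. of_real (coeff q k) * z ^ k) = (\<Sum>k<N. of_real (coeff q k) * z ^ k)"
    by (intro sum.mono_neutral_left) (auto simp: coeff_eq_0)
  then show ?thesis
    by (simp add: cpoly_def poly_altdef degree_map_poly coeff_map_poly)
qed

locale square_summable_polys =
  fixes p :: "nat \<Rightarrow> real poly"
  assumes degree_p: "\<And>n. degree (p n) = n" and lead_coeff_p: "\<And>n. lead_coeff (p n) > 0"
    and square_summable_p: "\<And>z. square_summable (\<lambda>n. cpoly (p n)) z"
    and locally_bounded_p: "locally_bounded (\<lambda>z. complex_of_real (l2 (\<lambda>n. cpoly (p n)) z))"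
begin

abbreviation "M_P \<equiv> max_modulus (\<lambda>z. complex_of_real (l2 (\<lambda>n. cpoly (p n)) z))"

lemma l2_le_M_P: "cmod z \<le> r \<Longrightarrow> l2 (\<lambda>n. cpoly (p n)) z \<le> M_P r"
  using locally_bounded_norm_le_max_modulus[OF locally_bounded_p] by fastforce

text \<open>Duality: the polynomial \<open>Q\<close> formed with the coefficients themselves as
  weights has \<open>S\<close> squared as its k-th coefficient. On the circle it is at most
  \<open>S * M_P R\<close> by Cauchy-Schwarz, so Cauchy's estimate gives the claim after division by
  \<open>S\<close>.\<close>

lemma L2_set_coeff_le:
  assumes "R > 0"
  shows "L2_set (\<lambda>n. coeff (p n) k) {..<N} \<le> M_P R / R ^ k"
proof -
  define S where "S = L2_set (\<lambda>n. coeff (p n) k) {..<N}"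
  define Q where "Q = (\<Sum>n<N. smult (of_real (coeff (p n) k)) (map_poly complex_of_real (p n)))"
  have S: "S \<ge> 0" by (simp add: S_def)
  have "cmod (poly Q z) \<le> S * M_P R" if z: "cmod z = R" for z
  proof -
    have "poly Q z = (\<Sum>n<N. of_real (coeff (p n) k) * cpoly (p n) z)"
      by (simp add: Q_def poly_sum cpoly_def)
    also have "cmod \<dots> \<le> S * L2_set (\<lambda>n. cmod (cpoly (p n) z)) {..<N}"
      using norm_sum_mult_le_L2_set[of "\<lambda>n. of_real (coeff (p n) k)" "\<lambda>n. cpoly (p n) z" "{..<N}"]
      by (simp add: S_def L2_set_def)
    also have "\<dots> \<le> S * M_P R"
      using S order_trans[OF L2_set_le_l2[OF square_summable_p[of z]] l2_le_M_P[of z R]] z by (intro mult_left_mono) auto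
    finally show ?thesis .
  qed
  from norm_coeff_le[OF assms this, of k] have "cmod (coeff Q k) \<le> S * M_P R / R ^ k" .
  moreover have "coeff Q k = of_real (S\<^sup>2)"
    by (simp add: Q_def coeff_sum coeff_map_poly S_def L2_set_def sum_nonneg power2_eq_square)
  then have "cmod (coeff Q k) = S\<^sup>2" by (simp only: norm_of_real) simp
  ultimately have "S * S \<le> S * (M_P R / R ^ k)" by (simp add: power2_eq_square)
  moreover have "M_P R / R ^ k \<ge> 0"
    using assms l2_le_M_P[of 0 R] l2_nonneg[OF square_summable_p, of 0] by simp
  ultimately have "S \<le> M_P R / R ^ k"
    using S mult_left_le_imp_le[of S S "M_P R / R ^ k"] by (cases "S = 0") auto
  then show ?thesis by (simp add: S_def)
qed

lemma c_coeff_bounds: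
  shows "L2_set (\<lambda>n. coeff (p n) k) {..<N} \<le> c_coeff p k"
    and "R > 0 \<Longrightarrow> c_coeff p k \<le> M_P R / R ^ k" and "c_coeff p k > 0"
proof -
  let ?u = "\<lambda>n z. complex_of_real (coeff (p n) k)"
  have L: "L2_set (\<lambda>n. cmod (?u n z)) {..<N} = L2_set (\<lambda>n. coeff (p n) k) {..<N}" for N z
    by (simp add: L2_set_def)
  have sq: "square_summable ?u z" for z :: complex
    by (rule l2_leI(1)[of _ _ "M_P 1"]) (use L2_set_coeff_le[of 1 k] L in auto)
  then have sm: "summable (\<lambda>n. (coeff (p n) k)\<^sup>2)" by (simp add: square_summable_def)
  \<comment> \<open>\<open>c_coeff\<close> sums from n = k on; the earlier terms vanish because
    \<open>p n\<close> has degree \<open>n\<close>.\<close>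
  have "(\<Sum>n. (coeff (p n) k)\<^sup>2) = (\<Sum>n. (coeff (p (n + k)) k)\<^sup>2) + (\<Sum>n<k. (coeff (p n) k)\<^sup>2)"
    by (rule suminf_split_initial_segment[OF sm])
  also have "(\<Sum>n<k. (coeff (p n) k)\<^sup>2) = 0"
    by (rule sum.neutral) (auto simp: coeff_eq_0 degree_p)
  finally have c: "c_coeff p k = l2 ?u z" for z :: complex
    by (simp add: c_coeff_def l2_def add.commute)
  show 1: "L2_set (\<lambda>n. coeff (p n) k) {..<N} \<le> c_coeff p k" for N
    using L2_set_le_l2[OF sq, of N 0] by (simp only: L c[of 0])
  show "c_coeff p k \<le> M_P R / R ^ k" if "R > 0"
    unfolding c[of 0] by (rule l2_leI(2)) (use L2_set_coeff_le[OF that] L in auto)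
  have "0 < coeff (p k) k" using lead_coeff_p[of k] by (simp add: degree_p)
  also have "\<dots> \<le> L2_set (\<lambda>n. coeff (p n) k) {..<Suc k}"
    by (rule order_trans[OF abs_ge_self]) (metis L lessThan_iff lessI finite_lessThan member_le_L2_set[of _ k "\<lambda>n. cmod (?u n 0)"] norm_of_real)
  also have "\<dots> \<le> c_coeff p k" by (rule 1)
  finally show "c_coeff p k > 0" .
qed

text \<open>Cauchy's estimate on the radius \<open>2 * r\<close> leaves a geometric factor, which
  gives convergence of the series of \<Phi> and a bound for its sum.\<close>

lemma c_coeff_power_le:
  assumes "r > 0" "0 \<le> x" "x \<le> r"
  shows "c_coeff p k * x ^ k \<le> M_P (2 * r) * (1 / 2) ^ k"
proof -
  have "c_coeff p k * x ^ k \<le> M_P (2 * r) / (2 * r) ^ k * r ^ k"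
    using assms c_coeff_bounds(2)[of "2 * r" k] c_coeff_bounds(3)[of k] by (intro mult_mono power_mono) auto
  also have "\<dots> = M_P (2 * r) * (1 / 2) ^ k"
    using assms by (simp add: power_mult_distrib power_divide)
  finally show ?thesis .
qed

lemma summable_Phi: "summable (\<lambda>k. c_coeff p k * x ^ k)" if "x \<ge> 0"
proof (rule summable_comparison_test')
  show "summable (\<lambda>k. M_P (2 * (x + 1)) * (1 / 2) ^ k)"
    by (intro summable_mult summable_geometric) auto
  show "norm (c_coeff p k * x ^ k) \<le> M_P (2 * (x + 1)) * (1 / 2) ^ k" for k
    using c_coeff_power_le[of "x + 1" x k] that c_coeff_bounds(3)[of k] by simp
qed

lemma norm_Phi_le:
  assumes "r > 0" "cmod z \<le> r"
  shows "cmod (Phi_fun p z) \<le> 2 * M_P (2 * r)"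
proof -
  have n: "norm (complex_of_real (c_coeff p k) * z ^ k) = c_coeff p k * cmod z ^ k" for k
    using c_coeff_bounds(3)[of k] by (simp add: norm_mult norm_power)
  have s: "summable (\<lambda>k. norm (complex_of_real (c_coeff p k) * z ^ k))"
    unfolding n by (rule summable_Phi) simp
  have g: "(\<lambda>k. M_P (2 * r) * (1 / 2) ^ k) sums (M_P (2 * r) * 2)"
    using sums_mult[OF geometric_sums[of "1 / 2 :: real"], of "M_P (2 * r)"] by simp
  have "cmod (Phi_fun p z) \<le> (\<Sum>k. norm (complex_of_real (c_coeff p k) * z ^ k))"
    unfolding Phi_fun_def by (rule summable_norm[OF s])
  also have "\<dots> \<le> M_P (2 * r) * 2"
    using s g c_coeff_power_le[OF assms(1) norm_ge_zero assms(2)] unfolding n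
    by (intro suminf_le_const sums_le[OF _ summable_sums g, THEN order_trans] ) (auto simp: sums_iff intro!: suminf_le)
  finally show ?thesis by simp
qed

lemma locally_bounded_Phi: "locally_bounded (Phi_fun p)"
  unfolding locally_bounded_def
proof (intro allI exI impI)
  fix r z assume "cmod z \<le> r"
  then show "cmod (Phi_fun p z) \<le> 2 * M_P (2 * (\<bar>r\<bar> + 1))" by (intro norm_Phi_le) auto
qed

text \<open>The coefficients are positive, so \<Phi> at the point \<open>x\<close> itself dominates
  its partial sums.\<close>

lemma partial_sum_le_max_modulus_Phi:
  assumes "0 \<le> x" "x \<le> r"
  shows "(\<Sum>k<N. c_coeff p k * x ^ k) \<le> max_modulus (Phi_fun p) r"
proof -
  have s: "summable (\<lambda>k. c_coeff p k * x ^ k)" by (rule summable_Phi[OF assms(1)])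
  have "(\<Sum>k<N. c_coeff p k * x ^ k) \<le> (\<Sum>k. c_coeff p k * x ^ k)"
    by (rule sum_le_suminf[OF s]) (use assms c_coeff_bounds(3) in \<open>auto simp: less_imp_le\<close>)
  also have "\<dots> \<le> cmod (complex_of_real (\<Sum>k. c_coeff p k * x ^ k))" by simp
  also have "complex_of_real (\<Sum>k. c_coeff p k * x ^ k) = Phi_fun p (of_real x)"
    unfolding Phi_fun_def using suminf_of_real[OF s, where 'a=complex] by simp
  also have "cmod \<dots> \<le> max_modulus (Phi_fun p) r"
    by (rule locally_bounded_norm_le_max_modulus[OF locally_bounded_Phi]) (use assms in simp)
  finally show ?thesis .
qed

lemma growth_Phi:
  "growth_le (Phi_fun p) (\<lambda>z. complex_of_real (l2 (\<lambda>n. cpoly (p n)) z))"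
  "growth_le (\<lambda>z. complex_of_real (l2 (\<lambda>n. cpoly (p n)) z)) (Phi_fun p)"
proof -
  show "growth_le (Phi_fun p) (\<lambda>z. complex_of_real (l2 (\<lambda>n. cpoly (p n)) z))"
    by (rule growth_leI[where C=2 and k=0 and L=2]) (use norm_Phi_le in auto)
  show "growth_le (\<lambda>z. complex_of_real (l2 (\<lambda>n. cpoly (p n)) z)) (Phi_fun p)"
  proof (rule growth_leI[where C=1 and k=0 and L=1])
    fix r z assume r: "1 \<le> r" and z: "cmod z \<le> r"
    have "L2_set (\<lambda>n. cmod (cpoly (p n) z)) {..<N} \<le> max_modulus (Phi_fun p) r" for N
    proof -
      \<comment> \<open>For n < N the degree is below N, so truncating the coefficient sum at the
        same N loses nothing. Minkowski's inequality then takes the sum over k outside.\<close>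
      have "L2_set (\<lambda>n. cmod (cpoly (p n) z)) {..<N} \<le> L2_set (\<lambda>n. \<Sum>k<N. cmod z ^ k * \<bar>coeff (p n) k\<bar>) {..<N}"
      proof (rule L2_set_mono)
        fix n assume "n \<in> {..<N}"
        then have "cpoly (p n) z = (\<Sum>k<N. of_real (coeff (p n) k) * z ^ k)"
          by (intro cpoly_eq_sum) (simp add: degree_p)
        then show "cmod (cpoly (p n) z) \<le> (\<Sum>k<N. cmod z ^ k * \<bar>coeff (p n) k\<bar>)"
          by (auto intro!: order_trans[OF norm_sum] sum_mono simp: norm_mult norm_power)
      qed auto
      also have "\<dots> \<le> (\<Sum>k<N. L2_set (\<lambda>n. cmod z ^ k * \<bar>coeff (p n) k\<bar>) {..<N})"
        by (rule L2_set_sum_triangle)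
      also have "\<dots> = (\<Sum>k<N. cmod z ^ k * L2_set (\<lambda>n. coeff (p n) k) {..<N})"
        by (simp add: L2_set_right_distrib[symmetric]) (simp add: L2_set_def)
      also have "\<dots> \<le> (\<Sum>k<N. cmod z ^ k * c_coeff p k)"
        by (intro sum_mono mult_left_mono c_coeff_bounds) auto
      also have "\<dots> = (\<Sum>k<N. c_coeff p k * cmod z ^ k)" by (simp add: mult.commute)
      also have "\<dots> \<le> max_modulus (Phi_fun p) r"
        using z by (intro partial_sum_le_max_modulus_Phi) auto
      finally show ?thesis .
    qed
    from l2_leI(2)[of "\<lambda>n. cpoly (p n)" z, OF this]
    show "cmod (complex_of_real (l2 (\<lambda>n. cpoly (p n)) z)) \<le> 1 * r ^ 0 * max_modulus (Phi_fun p) (1 * r)"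
      using l2_nonneg[OF square_summable_p] by simp
  qed auto
qed

text \<open>All \<open>c_coeff p k\<close> are positive, so a single term with k > c already exceeds
  \<open>r powr c\<close> eventually.\<close>

lemma superpolynomial_Phi: "superpolynomial (Phi_fun p)"
  unfolding superpolynomial_def
proof (intro allI notI)
  fix c :: real assume *: "\<forall>\<^sub>F r in at_top. max_modulus (Phi_fun p) r \<le> r powr c"
  obtain k :: nat where k: "real k > c" using reals_Archimedean2 by blast
  define d where "d = c_coeff p k"
  define m where "m = real k"
  have "d > 0" "m > c" using k c_coeff_bounds(3) by (auto simp: d_def m_def)
  then have "\<forall>\<^sub>F r in at_top. r powr c < d * r powr m" by real_asymp
  with * eventually_gt_at_top[of 0] have "\<forall>\<^sub>F r::real in at_top. False"
  proof eventually_elim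
    case (elim r)
    have "d * r ^ k \<le> (\<Sum>j<Suc k. c_coeff p j * r ^ j)"
      unfolding d_def by (rule member_le_sum[of k]) (use elim c_coeff_bounds(3) in \<open>auto simp: less_imp_le\<close>)
    also have "\<dots> \<le> max_modulus (Phi_fun p) r"
      using elim by (intro partial_sum_le_max_modulus_Phi) auto
    finally show ?case using elim by (simp add: m_def powr_realpow)
  qed
  then show False by simp
qed

end

section \<open>Stieltjes transforms\<close>

text \<open>With the sign x - z, the imaginary part of the transform has the sign of that of
  \<open>z\<close>, and the transform enters the Fourier coefficients below as w P + Q.\<close>

definition stieltjes :: "real measure \<Rightarrow> complex \<Rightarrow> complex" where
  "stieltjes M z = (LINT x|M. 1 / (complex_of_real x - z))"

lemma norm_resolvent_le:
  assumes "Im z \<noteq> 0"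
  shows "cmod (1 / (complex_of_real x - z)) \<le> 1 / \<bar>Im z\<bar>"
proof -
  have "\<bar>Im z\<bar> \<le> cmod (complex_of_real x - z)"
    using abs_Im_le_cmod[of "complex_of_real x - z"] by simp
  then show ?thesis using assms by (simp add: norm_divide frac_le)
qed

lemma Im_resolvent:
  "Im (1 / (complex_of_real x - z)) = Im z / (cmod (complex_of_real x - z))\<^sup>2"
  by (simp add: Im_divide cmod_power2)

context real_distribution
begin

lemma borel_measurable_resolvent [measurable]:
  "(\<lambda>x. 1 / (complex_of_real x - z)) \<in> borel_measurable M"
  by measurable

lemma integrable_resolvent:
  assumes "Im z \<noteq> 0"
  shows "integrable M (\<lambda>x. 1 / (complex_of_real x - z))"
  by (rule integrable_const_bound[where B="1 / \<bar>Im z\<bar>"]) (use norm_resolvent_le[OF assms] in auto)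

lemma norm_stieltjes_le:
  assumes "Im z \<noteq> 0"
  shows "cmod (stieltjes M z) * \<bar>Im z\<bar> \<le> 1"
proof -
  have "cmod (stieltjes M z) \<le> (LINT x|M. cmod (1 / (complex_of_real x - z)))"
    unfolding stieltjes_def by (rule integral_norm_bound)
  also have "\<dots> \<le> (LINT x|M. 1 / \<bar>Im z\<bar>)"
    using integrable_resolvent[OF assms] norm_resolvent_le[OF assms] by (intro integral_mono) auto
  also have "\<dots> = 1 / \<bar>Im z\<bar>" using prob_space by simp
  finally show ?thesis using assms by (simp add: field_simps)
qed

text \<open>The imaginary part of the transform is Im z times the integral of 1 / |x - z|^2, and |x
  - z| \<le> (1 + |x|) (1 + |z|) separates the variables. The constant is the integral of 1 / (1 +
  |x|)^2.\<close>

lemma norm_stieltjes_ge: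
  obtains c where "c > 0" "\<And>z. Im z \<noteq> 0 \<Longrightarrow> c * \<bar>Im z\<bar> \<le> cmod (stieltjes M z) * (1 + cmod z)\<^sup>2"
proof
  let ?g = "\<lambda>x::real. 1 / (1 + \<bar>x\<bar>)\<^sup>2"
  define c where "c = (LINT x|M. ?g x)"
  have g01: "0 \<le> ?g x" "?g x \<le> 1" for x :: real
  proof -
    have "1 \<le> (1 + \<bar>x\<bar>)\<^sup>2" by (rule one_le_power) auto
    then show "?g x \<le> 1" by (simp add: divide_simps)
  qed auto
  have int: "integrable M ?g"
    by (rule integrable_const_bound[where B=1]) (use g01 in auto)
  have "c \<noteq> 0"
  proof
    assume "c = 0"
    then have "AE x in M. ?g x = 0"
      using integral_nonneg_eq_0_iff_AE[OF int] g01 by (simp add: c_def)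
    then have "AE x in M. False" by eventually_elim (auto simp: add_pos_nonneg)
    then show False by (simp add: AE_False)
  qed
  moreover have "c \<ge> 0" unfolding c_def by (rule Bochner_Integration.integral_nonneg) (use g01 in auto)
  ultimately show "c > 0" by simp
  fix z assume z: "Im z \<noteq> 0"
  have pos: "(1 + cmod z)\<^sup>2 > 0" using norm_ge_zero[of z] by (intro zero_less_power) linarith
  let ?d = "\<lambda>x. (cmod (complex_of_real x - z))\<^sup>2"
  have d: "?g x / (1 + cmod z)\<^sup>2 \<le> 1 / ?d x" for x
  proof -
    have "complex_of_real x - z \<noteq> 0" using z by (auto simp: complex_eq_iff)
    then have 0: "?d x > 0" by simp
    have "cmod (complex_of_real x - z) \<le> \<bar>x\<bar> + cmod z"
      using norm_triangle_ineq4[of "complex_of_real x" z] by simp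
    also have "\<dots> \<le> (1 + \<bar>x\<bar>) * (1 + cmod z)" by (simp add: algebra_simps)
    finally have "?d x \<le> ((1 + \<bar>x\<bar>) * (1 + cmod z))\<^sup>2" by (rule power_mono) simp
    then have "1 / ((1 + \<bar>x\<bar>) * (1 + cmod z))\<^sup>2 \<le> 1 / ?d x"
      using 0 by (intro frac_le) auto
    then show ?thesis by (simp add: power_mult_distrib)
  qed
  have int2: "integrable M (\<lambda>x. 1 / ?d x)"
  proof -
    have "integrable M (\<lambda>x. Im (1 / (complex_of_real x - z)) / Im z)"
      using integrable_resolvent[OF z] by (intro integrable_divide integrable_Im)
    then show ?thesis unfolding Im_resolvent using z by simp
  qed
  have "c / (1 + cmod z)\<^sup>2 = (LINT x|M. ?g x / (1 + cmod z)\<^sup>2)"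
    by (simp only: c_def integral_divide_zero)
  also have "\<dots> \<le> (LINT x|M. 1 / ?d x)"
    by (rule integral_mono[OF integrable_divide[OF int] int2 d])
  finally have "\<bar>Im z\<bar> * (c / (1 + cmod z)\<^sup>2) \<le> \<bar>Im z\<bar> * (LINT x|M. 1 / ?d x)"
    by (rule mult_left_mono) simp
  also have "(LINT x|M. 1 / ?d x) \<ge> 0" by (rule Bochner_Integration.integral_nonneg) auto
  then have "\<bar>Im z\<bar> * (LINT x|M. 1 / ?d x) = \<bar>Im z * (LINT x|M. 1 / ?d x)\<bar>"
    by (simp add: abs_mult)
  also have "Im z * (LINT x|M. 1 / ?d x) = Im (stieltjes M z)"
  proof -
    have "Im z * (LINT x|M. 1 / ?d x) = (LINT x|M. Im z * (1 / ?d x))"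
      by (simp only: integral_mult_right_zero)
    also have "\<dots> = (LINT x|M. Im (1 / (complex_of_real x - z)))" by (simp add: Im_resolvent)
    also have "\<dots> = Im (stieltjes M z)"
      unfolding stieltjes_def by (rule integral_Im[OF integrable_resolvent[OF z]])
    finally show ?thesis .
  qed
  also have "\<bar>Im (stieltjes M z)\<bar> \<le> cmod (stieltjes M z)" by (rule abs_Im_le_cmod)
  finally show "c * \<bar>Im z\<bar> \<le> cmod (stieltjes M z) * (1 + cmod z)\<^sup>2"
    using pos by (simp add: field_simps)
qed

text \<open>On the line of height \<open>y\<close> the imaginary part of the transform is a Poisson
  integral up to a constant factor. By Fubini the integration over \<open>t\<close> can be done
  first, and the kernel has an arctan as antiderivative.\<close>

lemma integral_arctan_eq_stieltjes:
  assumes "a \<le> b" "y > 0"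
  shows "(LINT x|M. arctan ((b - x) / y) - arctan ((a - x) / y)) =
    (LINT t|lborel. indicator {a..b} t * Im (stieltjes M (Complex t y)))"
proof -
  let ?h = "\<lambda>x t. indicator {a..b} t * (y / ((x - t)\<^sup>2 + y\<^sup>2))"
  interpret P: pair_sigma_finite M lborel ..
  have "integrable (M \<Otimes>\<^sub>M lborel) (case_prod ?h)"
  proof (rule integrableI_bounded_set[where A="space M \<times> {a..b}" and B="1 / y"])
    show "emeasure (M \<Otimes>\<^sub>M lborel) (space M \<times> {a..b}) < \<infinity>"
      using assms emeasure_space_1 by (subst lborel.emeasure_pair_measure_Times) auto
    have "y / ((x - t)\<^sup>2 + y\<^sup>2) \<le> 1 / y" for x t
    proof -
      have "y / ((x - t)\<^sup>2 + y\<^sup>2) \<le> y / y\<^sup>2" using assms by (intro divide_left_mono) (auto simp: add_nonneg_pos)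
      then show ?thesis using assms by (simp add: power2_eq_square)
    qed
    moreover have "y / ((x - t)\<^sup>2 + y\<^sup>2) \<ge> 0" for x t using assms by simp
    ultimately show "AE x in M \<Otimes>\<^sub>M lborel. x \<in> space M \<times> {a..b} \<longrightarrow> norm (case_prod ?h x) \<le> 1 / y"
      using assms by (intro AE_I2) auto
    show "AE x in M \<Otimes>\<^sub>M lborel. x \<notin> space M \<times> {a..b} \<longrightarrow> case_prod ?h x = 0"
      by (intro AE_I2) (auto simp: space_pair_measure indicator_def split: if_splits)
    show "space M \<times> {a..b} \<in> sets (M \<Otimes>\<^sub>M lborel)" by (intro pair_measureI) auto
  qed measurable
  from P.Fubini_integral[OF this]
  have fub: "(LINT t|lborel. LINT x|M. ?h x t) = (LINT x|M. LINT t|lborel. ?h x t)" .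
  have 1: "(LINT t|lborel. ?h x t) = arctan ((b - x) / y) - arctan ((a - x) / y)" for x
  proof -
    have "(LINT t|lborel. indicator {a..b} t *\<^sub>R (y / ((x - t)\<^sup>2 + y\<^sup>2))) = arctan ((b - x) / y) - arctan ((a - x) / y)"
    proof (rule integral_FTC_Icc[OF assms(1)])
      fix t :: real
      have "((\<lambda>t. arctan ((t - x) / y)) has_real_derivative (inverse (1 + ((t - x) / y)\<^sup>2) * (1 / y))) (at t within {a..b})"
        using assms by (auto intro!: derivative_eq_intros)
      moreover have "inverse (1 + ((t - x) / y)\<^sup>2) * (1 / y) = y / ((x - t)\<^sup>2 + y\<^sup>2)"
      proof -
        have "(1 + ((t - x) / y)\<^sup>2) * y\<^sup>2 = (x - t)\<^sup>2 + y\<^sup>2"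
          using assms by (simp add: power_divide field_simps power2_commute)
        moreover have "inverse (1 + ((t - x) / y)\<^sup>2) * (1 / y) = y / ((1 + ((t - x) / y)\<^sup>2) * y\<^sup>2)"
          using assms by (simp add: divide_simps power2_eq_square)
        ultimately show ?thesis by simp
      qed
      ultimately show "((\<lambda>t. arctan ((t - x) / y)) has_vector_derivative (y / ((x - t)\<^sup>2 + y\<^sup>2))) (at t within {a..b})"
        by (simp add: has_real_derivative_iff_has_vector_derivative)
    next
      have "(x - t)\<^sup>2 + y\<^sup>2 \<noteq> 0" for t using assms by (simp add: add_nonneg_pos less_imp_neq[symmetric])
      then show "continuous_on {a..b} (\<lambda>t. y / ((x - t)\<^sup>2 + y\<^sup>2))"
        by (intro continuous_intros) auto
    qed
    then show ?thesis by simp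
  qed
  have 2: "(LINT x|M. ?h x t) = indicator {a..b} t * Im (stieltjes M (Complex t y))" for t
  proof -
    have "Im (stieltjes M (Complex t y)) = (LINT x|M. Im (1 / (complex_of_real x - Complex t y)))"
      unfolding stieltjes_def using assms by (subst integral_Im[OF integrable_resolvent]) auto
    also have "\<dots> = (LINT x|M. y / ((x - t)\<^sup>2 + y\<^sup>2))" by (simp add: Im_resolvent cmod_power2)
    finally show ?thesis by (simp only: integral_mult_right_zero)
  qed
  show ?thesis using fub unfolding 1 2 by simp
qed

text \<open>
  With \<open>m = n + 1\<close>, the endpoint \<open>b + 1 / m\<close> approaches \<open>b\<close> more slowly than the smoothing scale
  \<open>1 / m\<^sup>2\<close>, so that an atom at \<open>b\<close> is counted in full.
\<close>

lemma cdf_eq_lim_arctan: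
  "(\<lambda>n. LINT x|M. arctan ((b + 1 / real (Suc n) - x) / (1 / (real (Suc n))\<^sup>2))
        - arctan ((b - real (Suc n) - x) / (1 / (real (Suc n))\<^sup>2))) \<longlonglongrightarrow> pi * cdf M b"
    (is "(\<lambda>n. LINT x|M. ?f n x) \<longlonglongrightarrow> _")
proof -
  have "(\<lambda>n. LINT x|M. ?f n x) \<longlonglongrightarrow> (LINT x|M. pi * indicator {..b} x)"
  proof (rule integral_dominated_convergence[where w="\<lambda>x. pi"])
    have "\<bar>arctan u - arctan v\<bar> \<le> pi" for u v
      using arctan_bounded[of u] arctan_bounded[of v] by (auto simp: abs_if)
    then show "AE x in M. norm (?f n x) \<le> pi" for n by simp
    show "AE x in M. (\<lambda>n. ?f n x) \<longlonglongrightarrow> pi * indicator {..b} x"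
    proof (rule AE_I2)
      fix x
      have low: "(\<lambda>n. arctan ((b - real (Suc n) - x) / (1 / (real (Suc n))\<^sup>2))) \<longlonglongrightarrow> - (pi / 2)"
        by real_asymp
      have high: "(\<lambda>n. arctan ((b + 1 / real (Suc n) - x) / (1 / (real (Suc n))\<^sup>2))) \<longlonglongrightarrow> (if x \<le> b then pi / 2 else - (pi / 2))"
      proof -
        define d where "d = b - x"
        consider "d > 0" | "d = 0" | "d < 0" by linarith
        then have "(\<lambda>n. arctan ((d + 1 / real (Suc n)) / (1 / (real (Suc n))\<^sup>2))) \<longlonglongrightarrow> (if 0 \<le> d then pi / 2 else - (pi / 2))"
        proof cases
          case 1
          then have "(\<lambda>n. arctan ((d + 1 / real (Suc n)) / (1 / (real (Suc n))\<^sup>2))) \<longlonglongrightarrow> pi / 2" by real_asymp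
          then show ?thesis using 1 by simp
        next
          \<comment> \<open>The atom: the argument of arctan is (1/m) / (1/m^2) = m and still tends
            to infinity.\<close>
          case 2
          have "(\<lambda>n. arctan ((0 + 1 / real (Suc n)) / (1 / (real (Suc n))\<^sup>2))) \<longlonglongrightarrow> pi / 2" by real_asymp
          then show ?thesis using 2 by simp
        next
          case 3
          then have "(\<lambda>n. arctan ((d + 1 / real (Suc n)) / (1 / (real (Suc n))\<^sup>2))) \<longlonglongrightarrow> - (pi / 2)" by real_asymp
          then show ?thesis using 3 by simp
        qed
        then show ?thesis by (simp add: d_def algebra_simps)
      qed
      show "(\<lambda>n. ?f n x) \<longlonglongrightarrow> pi * indicator {..b} x"
        using tendsto_diff[OF high low] by (auto simp: indicator_def split: if_splits)
    qed
  qed auto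
  also have "(LINT x|M. pi * indicator {..b} x) = pi * cdf M b" by (simp add: cdf_def)
  finally show ?thesis .
qed

end

text \<open>Stieltjes inversion: both distribution functions are limits of the same integrals of the
  imaginary part of the transform.\<close>

lemma stieltjes_unique:
  assumes "real_distribution M" "real_distribution N"
    and eq: "\<And>z. Im z > 0 \<Longrightarrow> stieltjes M z = stieltjes N z"
  shows "M = N"
proof (rule cdf_unique[OF assms(1,2)], rule ext)
  interpret M: real_distribution M by fact
  interpret N: real_distribution N by fact
  fix b
  have "(LINT x|M. arctan ((b + 1 / real (Suc n) - x) / (1 / (real (Suc n))\<^sup>2))
        - arctan ((b - real (Suc n) - x) / (1 / (real (Suc n))\<^sup>2))) =
      (LINT x|N. arctan ((b + 1 / real (Suc n) - x) / (1 / (real (Suc n))\<^sup>2))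
        - arctan ((b - real (Suc n) - x) / (1 / (real (Suc n))\<^sup>2)))" for n
  proof -
    have ab: "b - real (Suc n) \<le> b + 1 / real (Suc n)" "1 / (real (Suc n))\<^sup>2 > 0"
      by (rule order_trans[of _ b]) auto
    show ?thesis
      unfolding M.integral_arctan_eq_stieltjes[OF ab] N.integral_arctan_eq_stieltjes[OF ab]
      using ab(2) by (simp add: eq)
  qed
  with M.cdf_eq_lim_arctan[of b] have "(\<lambda>n. LINT x|N. arctan ((b + 1 / real (Suc n) - x) / (1 / (real (Suc n))\<^sup>2))
        - arctan ((b - real (Suc n) - x) / (1 / (real (Suc n))\<^sup>2))) \<longlonglongrightarrow> pi * cdf M b"
    by simp
  from LIMSEQ_unique[OF this N.cdf_eq_lim_arctan[of b]] show "cdf M b = cdf N b" by simp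
qed

section \<open>Orthonormal polynomials\<close>

lemma map_poly_of_real:
  "map_poly complex_of_real (pCons a q) = pCons (of_real a) (map_poly of_real q)"
  "map_poly complex_of_real (q + r) = map_poly of_real q + map_poly of_real r"
  "map_poly complex_of_real (smult a q) = smult (of_real a) (map_poly of_real q)"
  by (rule poly_eqI; simp add: coeff_map_poly coeff_pCons split: nat.split)+

lemma poly_map_poly_of_real: "poly (map_poly complex_of_real q) (of_real x) = of_real (poly q x)"
  by (induction q) (simp_all add: map_poly_of_real)

lemma poly_cpoly: "cpoly q (of_real x) = of_real (poly q x)"
  by (simp add: cpoly_def poly_map_poly_of_real)

lemma cpoly_pCons: "cpoly (pCons a q) z = of_real a + z * cpoly q z"
  by (simp add: cpoly_def map_poly_of_real)

lemma cpoly_add: "cpoly (q + r) z = cpoly q z + cpoly r z"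
  by (simp add: cpoly_def map_poly_of_real)

lemma cpoly_smult: "cpoly (smult a q) z = of_real a * cpoly q z"
  by (simp add: cpoly_def map_poly_of_real)

text \<open>Horner's scheme yields (q(z) - q(w)) / (z - w) as a polynomial in w, with the right
  value q'(z) at w = z and no case distinction.\<close>

definition diff_quot :: "real poly \<Rightarrow> complex \<Rightarrow> complex poly" where
  "diff_quot q z = synthetic_div (map_poly of_real q) z"

lemma diff_quot_pCons: "diff_quot (pCons a q) z = pCons (cpoly q z) (diff_quot q z)"
  by (simp add: diff_quot_def cpoly_def map_poly_of_real)

lemma diff_quot_eq: "(z - w) * poly (diff_quot q z) w = cpoly q z - cpoly q w"
proof (induction q)
  case 0
  show ?case by (simp add: diff_quot_def cpoly_def)
next
  case (pCons a q)
  have "(z - w) * poly (diff_quot (pCons a q) z) w = (z - w) * cpoly q z + w * ((z - w) * poly (diff_quot q z) w)"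
    by (simp add: diff_quot_pCons algebra_simps)
  also have "\<dots> = cpoly (pCons a q) z - cpoly (pCons a q) w"
    unfolding pCons.IH by (simp add: cpoly_pCons algebra_simps)
  finally show ?case .
qed

text \<open>Synthetic division is characterised by an equation that is additive in the dividend, and
  its solution is unique.\<close>

lemma diff_quot_add: "diff_quot (q + r) z = diff_quot q z + diff_quot r z"
proof -
  let ?q = "map_poly complex_of_real q" and ?r = "map_poly complex_of_real r"
  have "(?q + ?r) + smult z (synthetic_div ?q z + synthetic_div ?r z) =
      (?q + smult z (synthetic_div ?q z)) + (?r + smult z (synthetic_div ?r z))"
    by (simp add: smult_add_right)
  also have "\<dots> = pCons (poly ?q z + poly ?r z) (synthetic_div ?q z + synthetic_div ?r z)"
    by (simp add: synthetic_div_correct)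
  finally have "synthetic_div ?q z + synthetic_div ?r z = synthetic_div (?q + ?r) z"
    by (rule conjunct2[OF synthetic_div_unique])
  then show ?thesis
    by (simp add: diff_quot_def map_poly_of_real)
qed

lemma diff_quot_smult: "diff_quot (smult a q) z = smult (of_real a) (diff_quot q z)"
  by (induction q) (simp_all add: diff_quot_pCons cpoly_smult, simp add: diff_quot_def)

lemma cpoly_pderiv: "cpoly (pderiv q) z = poly (diff_quot q z) z"
  by (induction q)
     (simp_all add: diff_quot_pCons pderiv_pCons cpoly_add cpoly_pCons, simp_all add: diff_quot_def cpoly_def)

text \<open>Needed for the second measure supplied by \<open>indeterminate\<close>, which is given
  only by its moments.\<close>

lemma has_moments_real_distribution:
  assumes "has_moments M s" "s 0 = 1"
  shows "real_distribution M"
proof -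
  have "integrable M (\<lambda>x. x ^ 0)" "(LINT x|M. x ^ 0) = 1" using assms unfolding has_moments_def by metis+
  then have "measure M (space M) = 1" by simp
  \<comment> \<open>The real-valued \<open>measure\<close> of a set of infinite mass is 0, so the
    value 1 excludes infinite total mass.\<close>
  then have "emeasure M (space M) = 1"
    using emeasure_eq_ennreal_measure[of M "space M"] measure_zero_top[of M "space M"] by (cases "emeasure M (space M) = \<top>") auto
  then interpret prob_space M by (rule prob_spaceI)
  show ?thesis
    by unfold_locales (use assms in \<open>simp add: has_moments_def\<close>)
qed

text \<open>The sum depends on the moments alone; hence all solutions of the moment problem share
  the polynomials of the second kind.\<close>

lemma
  assumes "has_moments M s"
  shows integrable_complex_poly: "integrable M (\<lambda>x. poly Q (complex_of_real x))"
    and integral_complex_poly: "(LINT x|M. poly Q (complex_of_real x)) = (\<Sum>i\<le>degree Q. coeff Q i * of_real (s i))"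
proof -
  have i: "integrable M (\<lambda>x. complex_of_real (x ^ n))" "(LINT x|M. complex_of_real (x ^ n)) = of_real (s n)" for n
    using assms unfolding has_moments_def by (auto simp del: of_real_power)
  have "poly Q (complex_of_real x) = (\<Sum>i\<le>degree Q. coeff Q i * complex_of_real (x ^ i))" for x
    by (simp add: poly_altdef)
  then show "integrable M (\<lambda>x. poly Q (complex_of_real x))"
    "(LINT x|M. poly Q (complex_of_real x)) = (\<Sum>i\<le>degree Q. coeff Q i * of_real (s i))"
    using i by (simp_all del: of_real_power)
qed

lemma integrable_real_poly:
  assumes "has_moments M s"
  shows "integrable M (poly q)"
proof -
  have "integrable M (\<lambda>x. Re (poly (map_poly of_real q) (complex_of_real x)))"
    by (intro integrable_Re integrable_complex_poly[OF assms])
  then show ?thesis by (simp add: poly_map_poly_of_real)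
qed

lemma integral_real_poly_eq:
  assumes "has_moments M s" "has_moments N s"
  shows "(LINT x|M. poly q x) = (LINT x|N. poly q x)"
proof -
  have "(LINT x|M. complex_of_real (poly q x)) = (LINT x|N. complex_of_real (poly q x))"
    using integral_complex_poly[OF assms(1), of "map_poly of_real q"] integral_complex_poly[OF assms(2), of "map_poly of_real q"]
    by (simp only: poly_map_poly_of_real)
  then show ?thesis by simp
qed

lemma orthonormal_polys_cong:
  assumes "has_moments M s" "has_moments N s" "orthonormal_polys M p"
  shows "orthonormal_polys N p"
  using assms(3)
  unfolding orthonormal_polys_def poly_mult[symmetric] integral_real_poly_eq[OF assms(1,2)] .

lemma second_kind_eq: "second_kind M p n z = (LINT x|M. poly (diff_quot (p n) z) (complex_of_real x))"
proof -
  have "(if complex_of_real x = z then cpoly (pderiv (p n)) z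
                else (cpoly (p n) z - complex_of_real (poly (p n) x)) / (z - complex_of_real x))
      = poly (diff_quot (p n) z) (complex_of_real x)" for x
    using diff_quot_eq[of z "of_real x" "p n"] by (auto simp: cpoly_pderiv poly_cpoly field_simps)
  then show ?thesis by (simp add: second_kind_def)
qed

text \<open>Formulated for an arbitrary solution, so that it can be interpreted a second time for
  another measure with the same moments.\<close>

locale orthonormal_moments =
  fixes M :: "real measure" and s :: "nat \<Rightarrow> real" and p :: "nat \<Rightarrow> real poly"
  assumes moments: "has_moments M s" and s_0: "s 0 = 1" and orth: "orthonormal_polys M p"
begin

sublocale real_distribution M
  by (rule has_moments_real_distribution[OF moments s_0])

section \<open>Orthogonal expansion and the three-term recurrence\<close>

definition ip :: "real poly \<Rightarrow> real poly \<Rightarrow> real" where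
  "ip f g = (LINT x|M. poly (f * g) x)"

lemma ip_commute: "ip f g = ip g f"
  by (simp add: ip_def mult.commute)

lemma ip_pCons: "ip (pCons 0 f) g = ip f (pCons 0 g)"
  by (simp add: ip_def mult_ac)

lemma ip_add: "ip (f + g) h = ip f h + ip g h"
proof -
  have eq: "poly ((f + g) * h) = (\<lambda>x. poly (f * h) x + poly (g * h) x)"
    by (rule ext) (simp add: distrib_right)
  then show ?thesis
    unfolding ip_def by (simp only: eq Bochner_Integration.integral_add[OF integrable_real_poly[OF moments] integrable_real_poly[OF moments]])
qed

lemma ip_smult: "ip (smult a f) g = a * ip f g"
  by (simp add: ip_def mult_ac)

lemma ip_sum: "ip (\<Sum>k\<in>A. f k) g = (\<Sum>k\<in>A. ip (f k) g)"
  by (induction A rule: infinite_finite_induct) (auto simp: ip_add, simp_all add: ip_def)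

lemma ip_p: "ip (p m) (p n) = (if m = n then 1 else 0)"
  using orth by (simp add: orthonormal_polys_def ip_def)

lemma degree_p: "degree (p n) = n" and lead_coeff_p: "coeff (p n) n > 0"
  using orth unfolding orthonormal_polys_def by metis+

lemma p_expansion_exists:
  assumes "degree f \<le> n"
  shows "\<exists>c. f = (\<Sum>k\<le>n. smult (c k) (p k))"
  using assms
proof (induction n arbitrary: f)
  case 0
  obtain a b where ab: "f = [:a:]" "p 0 = [:b:]" using 0 degree_p[of 0] by (metis degree_0_id degree_eq_zeroE le_0_eq)
  have "b \<noteq> 0" using lead_coeff_p[of 0] ab by simp
  then have "f = (\<Sum>k\<le>0. smult (a / b) (p k))" using ab by simp
  then show ?case by (intro exI[of _ "\<lambda>k. a / b"])
next
  case (Suc n)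
  define t where "t = coeff f (Suc n) / coeff (p (Suc n)) (Suc n)"
  have "degree (f - smult t (p (Suc n))) \<le> n"
  proof (rule degree_le, intro allI impI)
    fix i assume "n < i"
    then consider "i = Suc n" | "i > Suc n" by linarith
    then show "coeff (f - smult t (p (Suc n))) i = 0"
    proof cases
      case 1
      then show ?thesis using lead_coeff_p[of "Suc n"] by (simp add: t_def)
    next
      case 2
      then show ?thesis using Suc.prems by (simp add: coeff_eq_0 degree_p)
    qed
  qed
  from Suc.IH[OF this] obtain c where c: "f - smult t (p (Suc n)) = (\<Sum>k\<le>n. smult (c k) (p k))" by blast
  have "(\<Sum>k\<le>Suc n. smult ((c(Suc n := t)) k) (p k)) = (\<Sum>k\<le>n. smult (c k) (p k)) + smult t (p (Suc n))"
    by simp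
  also have "\<dots> = f" unfolding c[symmetric] by simp
  finally show ?case by metis
qed

lemma p_expansion:
  assumes "degree f \<le> n"
  shows "f = (\<Sum>k\<le>n. smult (ip f (p k)) (p k))"
proof -
  obtain c where c: "f = (\<Sum>k\<le>n. smult (c k) (p k))" using p_expansion_exists[OF assms] by blast
  have "ip f (p j) = c j" if "j \<le> n" for j
  proof -
    have "ip f (p j) = (\<Sum>k\<le>n. c k * (if k = j then 1 else 0))"
      by (subst c) (simp add: ip_sum ip_smult ip_p)
    also have "\<dots> = c j" using that by (simp add: if_distrib cong: if_cong)
    finally show ?thesis .
  qed
  then have "(\<Sum>k\<le>n. smult (ip f (p k)) (p k)) = (\<Sum>k\<le>n. smult (c k) (p k))" by simp
  with c show ?thesis by simp
qed

lemma ip_eq_0: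
  assumes "degree f < n"
  shows "ip f (p n) = 0"
proof -
  have "ip f (p n) = (\<Sum>k\<le>degree f. ip f (p k) * (if k = n then 1 else 0))"
    by (subst p_expansion[OF order_refl]) (simp add: ip_sum ip_smult ip_p)
  also have "\<dots> = 0" using assms by (intro sum.neutral) auto
  finally show ?thesis .
qed

lemma p_0: "p 0 = 1"
proof -
  obtain b where b: "p 0 = [:b:]" using degree_p[of 0] by (metis degree_eq_zeroE)
  have "b > 0" using lead_coeff_p[of 0] b by simp
  moreover have "b * b = 1" using ip_p[of 0 0] b prob_space by (simp add: ip_def)
  ultimately have "b = 1" by (metis abs_of_pos power2_eq_1_iff power2_eq_square less_le_not_le neg_less_0_iff_less zero_less_one)
  then show ?thesis using b by simp
qed

definition "jacobi_a n = ip (pCons 0 (p n)) (p n)"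
definition "jacobi_b n = ip (pCons 0 (p n)) (p (Suc n))"

lemma p_recurrence_0: "pCons 0 (p 0) = smult (jacobi_b 0) (p (Suc 0)) + smult (jacobi_a 0) (p 0)"
proof -
  have "degree (pCons 0 (p 0)) \<le> Suc 0" by (simp add: degree_p)
  from p_expansion[OF this] show ?thesis by (simp add: jacobi_a_def jacobi_b_def)
qed

lemma p_recurrence: "pCons 0 (p (Suc n)) =
  smult (jacobi_b (Suc n)) (p (Suc (Suc n))) + smult (jacobi_a (Suc n)) (p (Suc n)) + smult (jacobi_b n) (p n)"
proof -
  have "degree (pCons 0 (p (Suc n))) \<le> Suc (Suc n)" by (simp add: degree_pCons_le[THEN order_trans] degree_p)
  from p_expansion[OF this] have "pCons 0 (p (Suc n)) =
      (\<Sum>k<n. smult (ip (pCons 0 (p (Suc n))) (p k)) (p k)) + smult (ip (pCons 0 (p (Suc n))) (p n)) (p n)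
      + smult (jacobi_a (Suc n)) (p (Suc n)) + smult (jacobi_b (Suc n)) (p (Suc (Suc n)))"
    by (simp add: jacobi_a_def jacobi_b_def lessThan_Suc_atMost[symmetric])
  \<comment> \<open>Multiplication by x is symmetric and x p_k has degree at most n for k < n, so it
    is orthogonal to \<open>p (Suc n)\<close>.\<close>
  also have "(\<Sum>k<n. smult (ip (pCons 0 (p (Suc n))) (p k)) (p k)) = 0"
  proof (rule sum.neutral, rule ballI)
    fix k assume "k \<in> {..<n}"
    then have "degree (pCons 0 (p k)) < Suc n" by (simp add: degree_pCons_le[THEN le_less_trans] degree_p)
    then have "ip (pCons 0 (p k)) (p (Suc n)) = 0" by (rule ip_eq_0)
    moreover have "ip (pCons 0 (p (Suc n))) (p k) = ip (pCons 0 (p k)) (p (Suc n))"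
      by (metis ip_pCons ip_commute)
    ultimately show "smult (ip (pCons 0 (p (Suc n))) (p k)) (p k) = 0" by simp
  qed
  also have "ip (pCons 0 (p (Suc n))) (p n) = jacobi_b n"
    unfolding jacobi_b_def by (metis ip_pCons ip_commute)
  finally show ?thesis by (simp add: add_ac)
qed

text \<open>Compare the coefficients of degree n + 1 in the recurrence; both leading coefficients
  are positive.\<close>

lemma jacobi_b_pos: "jacobi_b n > 0"
proof -
  have "coeff (pCons 0 (p n)) (Suc n) = jacobi_b n * coeff (p (Suc n)) (Suc n)"
  proof (cases n)
    case 0
    show ?thesis unfolding 0 by (subst p_recurrence_0) (simp add: p_0)
  next
    case (Suc m)
    show ?thesis unfolding Suc by (subst p_recurrence) (simp add: coeff_eq_0 degree_p)
  qed
  then have "coeff (p n) n = jacobi_b n * coeff (p (Suc n)) (Suc n)" by simp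
  then show ?thesis using lead_coeff_p[of n] lead_coeff_p[of "Suc n"] by (metis zero_less_mult_pos2)
qed

text \<open>The extension to all polynomials is linear, so the recurrence of the \<open>p n\<close>
  can be carried over.\<close>

definition "second_kind_of q z = (LINT x|M. poly (diff_quot q z) (complex_of_real x))"

lemma second_kind_of_add: "second_kind_of (q + r) z = second_kind_of q z + second_kind_of r z"
  by (simp add: second_kind_of_def diff_quot_add integrable_complex_poly[OF moments])

lemma second_kind_of_smult: "second_kind_of (smult a q) z = of_real a * second_kind_of q z"
  by (simp add: second_kind_of_def diff_quot_smult)

text \<open>The extra integral is 0 for \<open>p n\<close> with n > 0, by orthogonality to
  \<open>p 0\<close>, and 1 for \<open>p 0\<close>: same recurrence, different initial
  values.\<close>

lemma second_kind_of_pCons: "second_kind_of (pCons 0 q) z = z * second_kind_of q z + of_real (LINT x|M. poly q x)"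
proof -
  have "poly (diff_quot (pCons 0 q) z) w = z * poly (diff_quot q z) w + cpoly q w" for w
    using diff_quot_eq[of z w q] by (simp add: diff_quot_pCons algebra_simps)
  then have "second_kind_of (pCons 0 q) z = (LINT x|M. z * poly (diff_quot q z) (complex_of_real x) + of_real (poly q x))"
    by (simp add: second_kind_of_def poly_cpoly)
  also have "\<dots> = z * second_kind_of q z + of_real (LINT x|M. poly q x)"
    unfolding second_kind_of_def by (subst Bochner_Integration.integral_add)
      (auto intro!: integrable_complex_poly[OF moments] integrable_of_real integrable_real_poly[OF moments])
  finally show ?thesis .
qed

lemma second_kind_of_1: "second_kind_of 1 z = 0"
  by (simp add: second_kind_of_def diff_quot_def one_pCons map_poly_of_real)

sublocale jacobi_recurrence jacobi_a jacobi_b "\<lambda>n. cpoly (p n)" "second_kind M p"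
proof
  have sk: "second_kind M p = (\<lambda>n. second_kind_of (p n))" by (intro ext) (simp add: second_kind_eq second_kind_of_def)
  have b: "complex_of_real (jacobi_b n) \<noteq> 0" for n using jacobi_b_pos[of n] by simp
  show "jacobi_b n > 0" for n by (rule jacobi_b_pos)
  show c0: "cpoly (p 0) z = 1" for z by (simp add: p_0 cpoly_def)
  have "cpoly (pCons 0 (p 0)) z = jacobi_b 0 * cpoly (p (Suc 0)) z + jacobi_a 0 * cpoly (p 0) z" for z
    unfolding p_recurrence_0 cpoly_add cpoly_smult ..
  then have "z = jacobi_b 0 * cpoly (p (Suc 0)) z + jacobi_a 0" for z
    by (simp add: cpoly_pCons c0)
  then show "cpoly (p (Suc 0)) z = (z - jacobi_a 0) / jacobi_b 0" for z
    using b by (metis add_diff_cancel_right' nonzero_mult_div_cancel_left)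
  show "second_kind M p 0 z = 0" for z by (simp add: sk p_0 second_kind_of_1)
  have "second_kind_of (pCons 0 (p 0)) z = jacobi_b 0 * second_kind_of (p (Suc 0)) z + jacobi_a 0 * second_kind_of (p 0) z" for z
    unfolding p_recurrence_0 second_kind_of_add second_kind_of_smult ..
  then show "second_kind M p (Suc 0) z = 1 / jacobi_b 0" for z
    using b prob_space by (simp add: second_kind_of_pCons sk p_0 second_kind_of_1 field_simps)
  show "three_term jacobi_a jacobi_b (\<lambda>n. cpoly (p n))"
    unfolding three_term_def
  proof (intro allI)
    fix n z
    have "z * cpoly (p (Suc n)) z = cpoly (pCons 0 (p (Suc n))) z" by (simp add: cpoly_pCons)
    then show "z * cpoly (p (Suc n)) z = jacobi_b (Suc n) * cpoly (p (Suc (Suc n))) z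
        + jacobi_a (Suc n) * cpoly (p (Suc n)) z + jacobi_b n * cpoly (p n) z"
      unfolding p_recurrence cpoly_add cpoly_smult .
  qed
  show "three_term jacobi_a jacobi_b (second_kind M p)"
    unfolding three_term_def sk
  proof (intro allI)
    fix n z
    have "(LINT x|M. poly (p (Suc n)) x) = 0"
      using ip_p[of "Suc n" 0] by (simp add: ip_def p_0)
    then have "z * second_kind_of (p (Suc n)) z = second_kind_of (pCons 0 (p (Suc n))) z" by (simp add: second_kind_of_pCons)
    then show "z * second_kind_of (p (Suc n)) z = jacobi_b (Suc n) * second_kind_of (p (Suc (Suc n))) z
        + jacobi_a (Suc n) * second_kind_of (p (Suc n)) z + jacobi_b n * second_kind_of (p n) z"
      unfolding p_recurrence second_kind_of_add second_kind_of_smult .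
  qed
qed

text \<open>Splitting p_n(x) as p_n(z) plus a multiple of x - z identifies w P_n + Q_n as the n-th
  Fourier coefficient of the resolvent 1 / (x - z).\<close>

lemma
  assumes "Im z \<noteq> 0"
  shows integrable_resolvent_p: "integrable M (\<lambda>x. 1 / (complex_of_real x - z) * of_real (poly (p n) x))"
    and integral_resolvent_p: "(LINT x|M. 1 / (complex_of_real x - z) * of_real (poly (p n) x)) =
      stieltjes M z * cpoly (p n) z + second_kind M p n z"
proof -
  have eq: "1 / (complex_of_real x - z) * of_real (poly (p n) x) =
      1 / (complex_of_real x - z) * cpoly (p n) z + poly (diff_quot (p n) z) (complex_of_real x)" for x
  proof -
    have "complex_of_real x - z \<noteq> 0" using assms by (auto simp: complex_eq_iff)
    moreover have "complex_of_real (poly (p n) x) = cpoly (p n) z + (complex_of_real x - z) * poly (diff_quot (p n) z) (complex_of_real x)"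
      using diff_quot_eq[of z "of_real x" "p n"] by (simp add: poly_cpoly algebra_simps)
    ultimately show ?thesis by (simp add: field_simps)
  qed
  have int: "integrable M (\<lambda>x. 1 / (complex_of_real x - z) * cpoly (p n) z)"
    "integrable M (\<lambda>x. poly (diff_quot (p n) z) (complex_of_real x))"
    by (intro integrable_mult_left integrable_resolvent[OF assms], rule integrable_complex_poly[OF moments])
  show "integrable M (\<lambda>x. 1 / (complex_of_real x - z) * of_real (poly (p n) x))"
    unfolding eq by (intro Bochner_Integration.integrable_add int)
  show "(LINT x|M. 1 / (complex_of_real x - z) * of_real (poly (p n) x)) =
      stieltjes M z * cpoly (p n) z + second_kind M p n z"
    unfolding eq Bochner_Integration.integral_add[OF int]
    by (simp only: stieltjes_def second_kind_eq integral_mult_left_zero)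
qed

text \<open>Expand the integral of |f - g|^2 \<ge> 0 with \<open>g\<close> the Fourier partial sum
  of the resolvent \<open>f\<close>: the two mixed integrals and that of |g|^2 all equal
  \<open>S\<close>, and |f| is at most 1 / |Im z|.\<close>

lemma bessel_resolvent:
  assumes z: "Im z \<noteq> 0"
  shows "L2_set (\<lambda>k. cmod (stieltjes M z * cpoly (p k) z + second_kind M p k z)) {..<N} * \<bar>Im z\<bar> \<le> 1"
proof -
  define f where "f x = 1 / (complex_of_real x - z)" for x
  define a where "a k = stieltjes M z * cpoly (p k) z + second_kind M p k z" for k
  define e where "e k x = complex_of_real (poly (p k) x)" for k x
  define g where "g x = (\<Sum>k<N. a k * e k x)" for x
  define S where "S = (\<Sum>k<N. (cmod (a k))\<^sup>2)"
  have fe: "integrable M (\<lambda>x. f x * e k x)" "(LINT x|M. f x * e k x) = a k" for k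
    unfolding f_def e_def a_def by (rule integrable_resolvent_p[OF z], rule integral_resolvent_p[OF z])
  have ee: "integrable M (\<lambda>x. e j x * e k x)" "(LINT x|M. e j x * e k x) = (if j = k then 1 else 0)" for j k
  proof -
    have *: "e j x * e k x = complex_of_real (poly (p j * p k) x)" for x by (simp add: e_def)
    show "integrable M (\<lambda>x. e j x * e k x)"
      unfolding * by (intro integrable_of_real integrable_real_poly[OF moments])
    have "(LINT x|M. complex_of_real (poly (p j * p k) x)) = of_real (ip (p j) (p k))"
      unfolding ip_def by (rule integral_complex_of_real)
    then show "(LINT x|M. e j x * e k x) = (if j = k then 1 else 0)"
      unfolding * by (simp add: ip_p)
  qed
  have ff: "integrable M (\<lambda>x. f x * cnj (f x))" "cmod (LINT x|M. f x * cnj (f x)) \<le> (1 / \<bar>Im z\<bar>)\<^sup>2"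
  proof -
    have le: "cmod (f x * cnj (f x)) \<le> (1 / \<bar>Im z\<bar>)\<^sup>2" for x
      using norm_resolvent_le[OF z, of x] unfolding norm_mult complex_mod_cnj power2_eq_square f_def
      by (intro mult_mono) auto
    show i: "integrable M (\<lambda>x. f x * cnj (f x))"
      by (rule integrable_const_bound[where B="(1 / \<bar>Im z\<bar>)\<^sup>2"]) (use le in \<open>auto simp: f_def\<close>)
    have "cmod (LINT x|M. f x * cnj (f x)) \<le> (LINT x|M. cmod (f x * cnj (f x)))" by (rule integral_norm_bound)
    also have "\<dots> \<le> (LINT x|M. (1 / \<bar>Im z\<bar>)\<^sup>2)" using i le by (intro integral_mono) auto
    also have "\<dots> = (1 / \<bar>Im z\<bar>)\<^sup>2" using prob_space by simp
    finally show "cmod (LINT x|M. f x * cnj (f x)) \<le> (1 / \<bar>Im z\<bar>)\<^sup>2" .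
  qed
  \<comment> \<open>The functions \<open>e k\<close> are real, so conjugation only affects the
    coefficients.\<close>
  have fg_eq: "f x * cnj (g x) = (\<Sum>k<N. cnj (a k) * (f x * e k x))" for x
    by (simp add: g_def e_def sum_distrib_left mult_ac)
  have fg: "integrable M (\<lambda>x. f x * cnj (g x))" "(LINT x|M. f x * cnj (g x)) = of_real S"
    unfolding fg_eq using fe by (auto simp: S_def complex_norm_square mult.commute simp flip: of_real_power)
  have gf: "integrable M (\<lambda>x. cnj (f x * cnj (g x)))" "(LINT x|M. cnj (f x * cnj (g x))) = of_real S"
    by (rule integrable_bounded_linear[OF bounded_linear_cnj fg(1)])
      (simp only: Bochner_Integration.integral_cnj fg(2) complex_cnj_complex_of_real)
  have gg_eq: "g x * cnj (g x) = (\<Sum>j<N. \<Sum>k<N. a j * cnj (a k) * (e j x * e k x))" for x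
    by (simp add: g_def e_def sum_product mult_ac)
  have gg: "integrable M (\<lambda>x. g x * cnj (g x))" "(LINT x|M. g x * cnj (g x)) = of_real S"
  proof -
    show "integrable M (\<lambda>x. g x * cnj (g x))"
      unfolding gg_eq by (intro Bochner_Integration.integrable_sum integrable_mult_right ee)
    have "(LINT x|M. g x * cnj (g x)) = (\<Sum>j<N. \<Sum>k<N. a j * cnj (a k) * (if j = k then 1 else 0))"
      unfolding gg_eq by (simp add: Bochner_Integration.integral_sum Bochner_Integration.integrable_sum integrable_mult_right ee(1) ee(2) del: mult_eq_if)
    also have "\<dots> = (\<Sum>j<N. a j * cnj (a j))"
      by (intro sum.cong refl) (simp add: if_distrib cong: if_cong)
    also have "\<dots> = of_real S" by (simp only: S_def of_real_sum complex_norm_square)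
    finally show "(LINT x|M. g x * cnj (g x)) = of_real S" .
  qed
  have "of_real ((cmod (f x - g x))\<^sup>2) = f x * cnj (f x) - f x * cnj (g x) - cnj (f x * cnj (g x)) + g x * cnj (g x)" for x
    unfolding complex_norm_square by (simp add: algebra_simps)
  then have "complex_of_real (LINT x|M. (cmod (f x - g x))\<^sup>2) =
      (LINT x|M. f x * cnj (f x) - f x * cnj (g x) - cnj (f x * cnj (g x)) + g x * cnj (g x))"
    by (simp only: integral_complex_of_real[symmetric])
  also have "\<dots> = (LINT x|M. f x * cnj (f x)) - of_real S"
    using ff(1) fg gf gg by (simp del: complex_cnj_mult complex_cnj_cnj)
  finally have "(LINT x|M. (cmod (f x - g x))\<^sup>2) = Re ((LINT x|M. f x * cnj (f x)) - of_real S)"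
    by (metis Re_complex_of_real)
  moreover have "(LINT x|M. (cmod (f x - g x))\<^sup>2) \<ge> 0" by (rule Bochner_Integration.integral_nonneg) simp
  ultimately have "S \<le> Re (LINT x|M. f x * cnj (f x))" by simp
  also have "\<dots> \<le> (1 / \<bar>Im z\<bar>)\<^sup>2" using ff(2) complex_Re_le_cmod order_trans by blast
  finally have "L2_set (\<lambda>k. cmod (a k)) {..<N} \<le> 1 / \<bar>Im z\<bar>"
    unfolding L2_set_def S_def by (intro real_le_lsqrt) (auto simp: sum_nonneg)
  then show ?thesis using z unfolding a_def by (simp add: field_simps)
qed

text \<open>At a point where the two transforms differ, Bessel's inequality for both measures bounds
  w P + Q and w' P + Q. Their difference (w - w') P bounds P, and then Q is bounded too.\<close>

lemma square_summable_indeterminate: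
  assumes "indeterminate s"
  obtains z0 where "square_summable (\<lambda>n. cpoly (p n)) z0" "square_summable (second_kind M p) z0"
proof -
  \<comment> \<open>Of two distinct solutions at least one differs from \<open>M\<close>.\<close>
  obtain N where N: "has_moments N s" "N \<noteq> M"
    using assms unfolding indeterminate_def by metis
  interpret N: orthonormal_moments N s p
    by unfold_locales (use N s_0 orthonormal_polys_cong[OF moments N(1) orth] in auto)
  have sk: "second_kind N p = second_kind M p"
    by (intro ext) (simp add: second_kind_eq integral_complex_poly[OF moments] integral_complex_poly[OF N(1)])
  obtain z where z: "Im z > 0" "stieltjes M z \<noteq> stieltjes N z"
    using stieltjes_unique[OF real_distribution_axioms N.real_distribution_axioms] N(2) by blast
  let ?w = "stieltjes M z" and ?w' = "stieltjes N z"
  let ?P = "\<lambda>K. L2_set (\<lambda>k. cmod (cpoly (p k) z)) {..<K}"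
  have b: "L2_set (\<lambda>k. cmod (?w * cpoly (p k) z + second_kind M p k z)) {..<K} \<le> 1 / Im z"
    "L2_set (\<lambda>k. cmod (- (?w' * cpoly (p k) z + second_kind M p k z))) {..<K} \<le> 1 / Im z" for K
    using bessel_resolvent[of z K] N.bessel_resolvent[of z K] z(1)
    by (simp_all only: norm_minus_cancel sk) (simp_all add: pos_le_divide_eq)
  have w: "L2_set (\<lambda>k. cmod (c * cpoly (p k) z)) {..<K} = cmod c * ?P K" for c K
    by (simp add: norm_mult L2_set_right_distrib)
  have P: "?P K \<le> 2 / Im z / cmod (?w - ?w')" for K
  proof -
    have "cmod (?w - ?w') * ?P K \<le> 1 / Im z + 1 / Im z"
      using L2_set_norm_triangle[of "\<lambda>k. ?w * cpoly (p k) z + second_kind M p k z"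
          "\<lambda>k. - (?w' * cpoly (p k) z + second_kind M p k z)" "{..<K}"] b[of K]
      by (simp add: w[symmetric] left_diff_distrib)
    then show ?thesis using z by (simp add: field_simps)
  qed
  have "L2_set (\<lambda>k. cmod (second_kind M p k z)) {..<K} \<le> 1 / Im z + cmod ?w * (2 / Im z / cmod (?w - ?w'))" for K
  proof -
    have "L2_set (\<lambda>k. cmod (second_kind M p k z)) {..<K} \<le> 1 / Im z + cmod ?w * ?P K"
      using L2_set_norm_triangle[of "\<lambda>k. ?w * cpoly (p k) z + second_kind M p k z"
          "\<lambda>k. - ?w * cpoly (p k) z" "{..<K}"] b(1)[of K] w[of "- ?w" K]
      by simp
    also have "\<dots> \<le> 1 / Im z + cmod ?w * (2 / Im z / cmod (?w - ?w'))"
      by (intro add_left_mono mult_left_mono P) auto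
    finally show ?thesis .
  qed
  from l2_leI(1)[of "second_kind M p" z, OF this] l2_leI(1)[of "\<lambda>n. cpoly (p n)" z, OF P]
  show thesis by (rule that[rotated])
qed

lemma growth_moment_funs:
  assumes "indeterminate s" "f \<in> moment_funs M p"
  shows "growth_le f (Phi_fun p)" "growth_le (Phi_fun p) f" "superpolynomial (Phi_fun p)"
proof -
  obtain z0 where z0: "square_summable (\<lambda>n. cpoly (p n)) z0" "square_summable (second_kind M p) z0"
    using square_summable_indeterminate[OF assms(1)] .
  interpret R: indeterminate_recurrence jacobi_a jacobi_b "\<lambda>n. cpoly (p n)" "second_kind M p" z0
    by unfold_locales (fact z0)+
  interpret S: square_summable_polys p
    by unfold_locales (use degree_p lead_coeff_p R.square_summable(1) R.locally_bounded_l2 in auto)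
  obtain c where c: "c > 0" "\<And>z. Im z \<noteq> 0 \<Longrightarrow> c * \<bar>Im z\<bar> \<le> cmod (stieltjes M z) * (1 + cmod z)\<^sup>2"
    by (rule norm_stieltjes_ge) blast
  note PQ = R.growth_p_q[OF c(1) norm_stieltjes_le c(2) bessel_resolvent]
  have eq: "A_fun M p = R.fA" "B_fun M p = R.fB" "C_fun M p = R.fC" "D_fun p = R.fD"
    "P_fun p = (\<lambda>z. complex_of_real (l2 (\<lambda>n. cpoly (p n)) z))"
    "Q_fun M p = (\<lambda>z. complex_of_real (l2 (second_kind M p) z))"
    by (simp_all add: fun_eq_iff A_fun_def B_fun_def C_fun_def D_fun_def P_fun_def Q_fun_def l2_def
        R.fA_def R.fB_def R.fC_def R.fD_def)
  note PPhi = S.growth_Phi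
  have QPhi: "growth_le (Q_fun M p) (Phi_fun p)" "growth_le (Phi_fun p) (Q_fun M p)"
    unfolding eq using PQ PPhi growth_le_trans by blast+
  show "growth_le f (Phi_fun p)" "growth_le (Phi_fun p) f"
    using assms(2) PPhi QPhi R.growth_equivalences growth_le_trans
    unfolding moment_funs_def eq by blast+
  show "superpolynomial (Phi_fun p)" by (rule S.superpolynomial_Phi)
qed

end

theorem theorem3p2:
  fixes \<mu> :: "real measure" and s :: "nat \<Rightarrow> real" and p :: "nat \<Rightarrow> real poly"
  assumes "normalized_hamburger \<mu> s"
    and "indeterminate s"
    and "orthonormal_polys \<mu> p"
    and "moment_problem_order \<mu> p 0"
  shows "moment_problem_log_order \<mu> p (log_order (Phi_fun p)) \<and>
         (log_order (Phi_fun p) < \<infinity> \<longrightarrow> moment_problem_log_type \<mu> p (log_type (Phi_fun p)))"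
proof -
  interpret real_distribution \<mu> using assms(1) by (simp add: normalized_hamburger_def)
  have moments: "has_moments \<mu> s" using assms(1) by (simp add: normalized_hamburger_def)
  then have "(LINT x|\<mu>. x ^ 0) = s 0" unfolding has_moments_def by blast
  then have "s 0 = 1" using prob_space by simp
  then interpret orthonormal_moments \<mu> s p
    by unfold_locales (use moments assms(3) in auto)
  note growth = growth_moment_funs[OF assms(2)]
  have order: "log_order f = log_order (Phi_fun p)" if "f \<in> moment_funs \<mu> p" for f
    using log_order_mono growth[OF that] by (intro antisym) auto
  \<comment> \<open>Both directions of the type comparison ask for superpolynomial growth of the
    larger function; \<open>f\<close> inherits it from \<Phi>.\<close>
  have "log_type f = log_type (Phi_fun p)"
    if "f \<in> moment_funs \<mu> p" "log_order (Phi_fun p) < \<infinity>" for f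
    using that growth[OF that(1)] order[OF that(1)] superpolynomial_mono[of "Phi_fun p" f]
    by (intro antisym log_type_mono) auto
  with order show ?thesis
    by (auto simp: moment_problem_log_order_def moment_problem_log_type_def)
qed

end
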